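(* Let $A$ be a closed symmetric relation in a separable Hilbert space $\mathcal H$ and let $\{\mathcal G,\Gamma_0,\Gamma_1\}$ be a quasi boundary triple for $A^*$ with $A_0=\ker\Gamma_0$, $\gamma$-field $\gamma$ and Weyl function $M$. Let $\mathfrak A$ be a class of operator ideals and let $\Theta$ be a symmetric relation in $\mathcal G$ such that the following conditions hold: (i) the closure $\overline{\Theta-M(\lambda_0)}$ is injective (i.e. has trivial kernel) for some $\lambda_0\in\mathbb C\setminus\mathbb R$; (ii) $\gamma(\lambda_1)^*\in\mathfrak A^*(\mathcal H,\mathcal G)$ for some $\lambda_1\in\rho(A_0)$; (iii) $A_\Theta=A_\Theta^*$. Then $$(A_\Theta-\lambda)^{-1}-(A_0-\lambda)^{-1}\in\mathfrak A(\mathcal H)$$ for all $\lambda\in\rho(A_\Theta)\cap\rho(A_0)$.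
   Context: Linear relations. A (closed) linear relation in a Hilbert space $\mathcal H$ is a (closed) linear subspace of $\mathcal H\times\mathcal H$; elements are written $\hat f=\binom{f}{f'}$, and operators are identified with their graphs; the closure of a relation is its closure in $\mathcal H\times\mathcal H$. $\ker S=\{f:\binom f0\in S\}$, $S-\lambda=\{\binom{f}{f'-\lambda f}:\binom f{f'}\in S\}$. For a relation $\Theta$ and an operator $M$ in $\mathcal G$, $\Theta-M=\{\binom{x}{y-Mx}:\binom xy\in\Theta,\ x\in\operatorname{dom}M\}$. For closed $S$, $\rho(S)$ is the set of $\lambda\in\mathbb C$ such that $(S-\lambda)^{-1}$ is a bounded everywhere defined operator. The adjoint is $S^*=\{\binom g{g'}:(f',g)=(f,g')\text{ for all }\binom f{f'}\in S\}$; $S$ is symmetric if $S\subset S^*$ and self-adjoint if $S=S^*$. Quasi boundary triples. Let $A$ be a closed symmetric relation in $\mathcal H$. $\{\mathcal G,\Gamma_0,\Gamma_1\}$ is a quasi boundary triple for $A^*$ if $\mathcal G$ is a Hilbert space and $\Gamma_0,\Gamma_1:T\to\mathcal G$ are linear mappings defined on a dense subspace $T$ of $A^*$ (dense in $A^*$ with respect to the topology of $\mathcal H\times\mathcal H$) such that $\Gamma=\binom{\Gamma_0}{\Gamma_1}:T\to\mathcal G\times\mathcal G$ has dense range, $\ker\Gamma_0$ is a self-adjoint relation in $\mathcal H$, and $(f',g)-(f,g')=(\Gamma_1\hat f,\Gamma_0\hat g)-(\Gamma_0\hat f,\Gamma_1\hat g)$ for all $\hat f=\binom f{f'},\hat g=\binom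 g{g'}\in T$. If $\mathcal H$ is separable, so is $\mathcal G$. For a linear relation $\Theta$ in $\mathcal G$ put $A_\Theta=\{\hat f\in T:\Gamma\hat f\in\Theta\}$. $\gamma$-field and Weyl function. Let $A_0=\ker\Gamma_0$ and $\mathcal G_0=\operatorname{ran}\Gamma_0$ (dense in $\mathcal G$). For $\lambda\in\rho(A_0)$ let $\hat{\mathcal N}_{\lambda,T}=\{\binom{f}{\lambda f}: f\in\ker(T-\lambda)\}$; then $\Gamma_0$ restricted to $\hat{\mathcal N}_{\lambda,T}$ is a bijection onto $\mathcal G_0$. With $\pi_1$ the projection of $\mathcal H\times\mathcal H$ onto the first component, define $\gamma(\lambda)=\pi_1(\Gamma_0\upharpoonright\hat{\mathcal N}_{\lambda,T})^{-1}:\mathcal G_0\to\mathcal H$ and $M(\lambda)=\Gamma_1(\Gamma_0\upharpoonright\hat{\mathcal N}_{\lambda,T})^{-1}:\mathcal G_0\to\mathcal G$, regarded as densely defined operators with domain $\mathcal G_0\subset\mathcal G$. $\gamma(\lambda)$ is bounded, so $\gamma(\lambda)^*\in\mathcal B(\mathcal H,\mathcal G)$. Operator ideals. All Hilbert spaces here are separable; $\mathcal B(\mathcal H,\mathcal K)$ are the bounded, $\mathfrak S_\infty(\mathcal H,\mathcal K)$ the compact operators. A class of operator ideals $\mathfrak A$ consists of subsets $\mathfrak A(\mathcal H,\mathcal K)\subset\mathfrak S_\infty(\mathcal H,\mathcal K)$ for every pair of Hilbert spaces, such that: rank-one operators $x\mapsto(x,u)v$ lie in $\mathfrak A(\mathcal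 H,\mathcal K)$; $\mathfrak A(\mathcal H,\mathcal K)$ is closed under addition; $CAB\in\mathfrak A(\mathcal H_1,\mathcal K_1)$ for $A\in\mathfrak A(\mathcal H,\mathcal K)$, $B\in\mathcal B(\mathcal H_1,\mathcal H)$, $C\in\mathcal B(\mathcal K,\mathcal K_1)$. $\mathfrak A^*(\mathcal K,\mathcal H)=\{A^*:A\in\mathfrak A(\mathcal H,\mathcal K)\}$; $\mathfrak A(\mathcal H)=\mathfrak A(\mathcal H,\mathcal H)$. *)

theory Defs
  imports "HOL-Analysis.Analysis"
begin

section \<open>Complex inner product spaces\<close>

text \<open>
  Complex inner product spaces, as real inner product spaces with a compatible complex structure,
  so that the norm and the topology are those of \<^class>\<open>real_inner\<close>. The sesquilinear inner
  product is linear in its first argument.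
\<close>

class complex_inner = real_inner +
  fixes scaleC :: "complex \<Rightarrow> 'a \<Rightarrow> 'a" (infixr "*\<^sub>C" 75)
    and cinner :: "'a \<Rightarrow> 'a \<Rightarrow> complex"
  assumes scaleC_add_right: "c *\<^sub>C (x + y) = c *\<^sub>C x + c *\<^sub>C y"
    and scaleC_add_left: "(c + d) *\<^sub>C x = c *\<^sub>C x + d *\<^sub>C x"
    and scaleC_scaleC: "c *\<^sub>C d *\<^sub>C x = (c * d) *\<^sub>C x"
    and scaleC_of_real: "complex_of_real r *\<^sub>C x = r *\<^sub>R x"
    and cinner_commute: "cinner x y = cnj (cinner y x)"
    and cinner_add_left: "cinner (x + y) z = cinner x z + cinner y z"
    and cinner_scaleC_left: "cinner (c *\<^sub>C x) y = c * cinner x y"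
    and inner_eq_Re_cinner: "inner x y = Re (cinner x y)"

lemma scaleC_one: "1 *\<^sub>C x = (x :: 'a :: complex_inner)"
  using scaleC_of_real[of 1 x] by simp

global_interpretation complex_vector: vector_space "scaleC :: complex \<Rightarrow> 'a \<Rightarrow> 'a :: complex_inner"
  defines csubspace_raw_def: csubspace = complex_vector.subspace
  by unfold_locales (simp_all add: scaleC_add_right scaleC_add_left scaleC_scaleC scaleC_one)

instantiation complex :: complex_inner
begin

definition scaleC_complex :: "complex \<Rightarrow> complex \<Rightarrow> complex"
  where "scaleC_complex c x = c * x"

definition cinner_complex :: "complex \<Rightarrow> complex \<Rightarrow> complex"
  where "cinner_complex x y = x * cnj y"

instance
  by standard
    (simp_all add: scaleC_complex_def cinner_complex_def algebra_simps scaleR_conv_of_real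
      inner_complex_def)

end

instantiation prod :: (complex_inner, complex_inner) complex_inner
begin

definition scaleC_prod :: "complex \<Rightarrow> 'a \<times> 'b \<Rightarrow> 'a \<times> 'b"
  where "scaleC_prod c x = (c *\<^sub>C fst x, c *\<^sub>C snd x)"

definition cinner_prod :: "'a \<times> 'b \<Rightarrow> 'a \<times> 'b \<Rightarrow> complex"
  where "cinner_prod x y = cinner (fst x) (fst y) + cinner (snd x) (snd y)"

instance
proof
  fix x y :: "'a \<times> 'b"
  show "cinner x y = cnj (cinner y x)"
    unfolding cinner_prod_def complex_cnj_add by (intro arg_cong2[where f = "(+)"] cinner_commute)
qed (simp_all add: scaleC_prod_def cinner_prod_def scaleC_add_right scaleC_add_left scaleC_scaleC
    scaleC_of_real cinner_add_left cinner_scaleC_left inner_eq_Re_cinner inner_prod_def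
    scaleR_prod_def distrib_left)

end


section \<open>Hilbert spaces\<close>

text \<open>
  Several Hilbert spaces, and all pairs of them, have to be considered at once. They are therefore
  modelled as the complete complex subspaces of an inner product space \<open>'a\<close>. As \<open>'a\<close> is arbitrary,
  this is no restriction: given Hilbert spaces \<open>H\<close> and \<open>G\<close>, take for \<open>'a\<close> their orthogonal sum
  (or that of any further Hilbert spaces).
\<close>

definition hilbert_space :: "'a :: complex_inner set \<Rightarrow> bool"
  where "hilbert_space H \<longleftrightarrow> csubspace H \<and> complete H"

definition separable_hilbert_space :: "'a :: complex_inner set \<Rightarrow> bool"
  where "separable_hilbert_space H \<longleftrightarrow> hilbert_space H \<and> separable_space (top_of_set H)"


section \<open>Linear relations\<close>

text \<open>
  Operators are identified with their graphs throughout. A linear relation from \<open>H\<close> to \<open>K\<close> is a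
  subspace of \<open>H \<times> K\<close>; as \<open>H\<close> and \<open>K\<close> are complete, hence closed in \<open>'a\<close>, its closedness and its
  closure in \<open>H \<times> K\<close> are given by \<^const>\<open>closed\<close> and \<^const>\<open>closure\<close> in \<open>'a \<times> 'a\<close>. The inverse of
  a relation \<open>S\<close> is \<open>S\<inverse>\<close>, and the product \<open>C B\<close> of operators is \<open>B O C\<close>.
\<close>

definition linear_relation :: "'a set \<Rightarrow> 'a set \<Rightarrow> ('a \<times> 'a :: complex_inner) set \<Rightarrow> bool"
  where "linear_relation H K S \<longleftrightarrow> S \<subseteq> H \<times> K \<and> csubspace S"

definition rel_ker :: "('a \<times> 'a :: complex_inner) set \<Rightarrow> 'a set"
  where "rel_ker S = {f. (f, 0) \<in> S}"

definition rel_shift :: "('a \<times> 'a :: complex_inner) set \<Rightarrow> complex \<Rightarrow> ('a \<times> 'a) set"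
  where "rel_shift S \<mu> = {(f, f' - \<mu> *\<^sub>C f) | f f'. (f, f') \<in> S}"

definition rel_add :: "('a \<times> 'a :: complex_inner) set \<Rightarrow> ('a \<times> 'a) set \<Rightarrow> ('a \<times> 'a) set"
  where "rel_add R S = {(x, y + z) | x y z. (x, y) \<in> R \<and> (x, z) \<in> S}"

definition rel_diff :: "('a \<times> 'a :: complex_inner) set \<Rightarrow> ('a \<times> 'a) set \<Rightarrow> ('a \<times> 'a) set"
  where "rel_diff R S = {(x, y - z) | x y z. (x, y) \<in> R \<and> (x, z) \<in> S}"

text \<open>
  The adjoint, a relation from \<open>K\<close> to \<open>H\<close>, of a relation \<open>S\<close> from \<open>H\<close> to \<open>K\<close>. For a densely
  defined operator \<open>S\<close> it is the graph of the adjoint operator.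
\<close>

definition rel_adj :: "'a set \<Rightarrow> 'a set \<Rightarrow> ('a \<times> 'a :: complex_inner) set \<Rightarrow> ('a \<times> 'a) set"
  where "rel_adj H K S =
    {(g, g'). g \<in> K \<and> g' \<in> H \<and> (\<forall>(f, f') \<in> S. cinner f' g = cinner f g')}"

definition symmetric_relation :: "'a set \<Rightarrow> ('a \<times> 'a :: complex_inner) set \<Rightarrow> bool"
  where "symmetric_relation H S \<longleftrightarrow> linear_relation H H S \<and> S \<subseteq> rel_adj H H S"

definition self_adjoint_relation :: "'a set \<Rightarrow> ('a \<times> 'a :: complex_inner) set \<Rightarrow> bool"
  where "self_adjoint_relation H S \<longleftrightarrow> linear_relation H H S \<and> S = rel_adj H H S"


section \<open>Operator ideals\<close>

definition bounded_ops :: "'a set \<Rightarrow> 'a set \<Rightarrow> ('a \<times> 'a :: complex_inner) set set"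
  where "bounded_ops H K =
    {B. linear_relation H K B \<and> (\<forall>x\<in>H. \<exists>!y. (x, y) \<in> B) \<and>
        (\<exists>c. \<forall>(x, y)\<in>B. norm y \<le> c * norm x)}"

definition compact_ops :: "'a set \<Rightarrow> 'a set \<Rightarrow> ('a \<times> 'a :: complex_inner) set set"
  where "compact_ops H K =
    {B \<in> bounded_ops H K. compact (closure (B `` {x \<in> H. norm x \<le> 1}))}"

definition resolvent_set :: "'a set \<Rightarrow> ('a \<times> 'a :: complex_inner) set \<Rightarrow> complex set"
  where "resolvent_set H S = {\<mu>. (rel_shift S \<mu>)\<inverse> \<in> bounded_ops H H}"

definition operator_ideal_class ::
    "('a set \<Rightarrow> 'a set \<Rightarrow> ('a \<times> 'a :: complex_inner) set set) \<Rightarrow> bool"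
  where "operator_ideal_class \<AA> \<longleftrightarrow>
    (\<forall>H K. separable_hilbert_space H \<and> separable_hilbert_space K \<longrightarrow>
      \<AA> H K \<subseteq> compact_ops H K \<and>
      (\<forall>u\<in>H - {0}. \<forall>v\<in>K - {0}. {(x, cinner x u *\<^sub>C v) | x. x \<in> H} \<in> \<AA> H K) \<and>
      (\<forall>A\<in>\<AA> H K. \<forall>B\<in>\<AA> H K. rel_add A B \<in> \<AA> H K)) \<and>
    (\<forall>H K H\<^sub>1 K\<^sub>1. separable_hilbert_space H \<and> separable_hilbert_space K \<and>
      separable_hilbert_space H\<^sub>1 \<and> separable_hilbert_space K\<^sub>1 \<longrightarrow>
      (\<forall>A\<in>\<AA> H K. \<forall>B\<in>bounded_ops H\<^sub>1 H. \<forall>C\<in>bounded_ops K K\<^sub>1. B O A O C \<in> \<AA> H\<^sub>1 K\<^sub>1))"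

definition dual_ideal_class ::
    "('a set \<Rightarrow> 'a set \<Rightarrow> ('a \<times> 'a :: complex_inner) set set) \<Rightarrow>
     'a set \<Rightarrow> 'a set \<Rightarrow> ('a \<times> 'a) set set"
  where "dual_ideal_class \<AA> K H = rel_adj H K ` \<AA> H K"


section \<open>Quasi boundary triples\<close>

text \<open>Only the values of the maps \<open>\<Gamma>\<^sub>0\<close> and \<open>\<Gamma>\<^sub>1\<close> on their domain \<open>T\<close> are relevant.\<close>

definition linear_map_on :: "'b :: complex_inner set \<Rightarrow> 'a :: complex_inner set \<Rightarrow> ('b \<Rightarrow> 'a) \<Rightarrow> bool"
  where "linear_map_on T G F \<longleftrightarrow>
    csubspace T \<and> F ` T \<subseteq> G \<and>
    (\<forall>x\<in>T. \<forall>y\<in>T. F (x + y) = F x + F y) \<and>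
    (\<forall>c. \<forall>x\<in>T. F (c *\<^sub>C x) = c *\<^sub>C F x)"

definition map_ker :: "('a \<times> 'a :: complex_inner) set \<Rightarrow> ('a \<times> 'a \<Rightarrow> 'a) \<Rightarrow> ('a \<times> 'a) set"
  where "map_ker T F = {f \<in> T. F f = 0}"

definition quasi_boundary_triple ::
    "'a set \<Rightarrow> ('a \<times> 'a :: complex_inner) set \<Rightarrow> ('a \<times> 'a) set \<Rightarrow> 'a set \<Rightarrow>
     ('a \<times> 'a \<Rightarrow> 'a) \<Rightarrow> ('a \<times> 'a \<Rightarrow> 'a) \<Rightarrow> bool"
  where "quasi_boundary_triple H A T G \<Gamma>\<^sub>0 \<Gamma>\<^sub>1 \<longleftrightarrow>
    hilbert_space G \<and>
    T \<subseteq> rel_adj H H A \<and> rel_adj H H A \<subseteq> closure T \<and>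
    linear_map_on T G \<Gamma>\<^sub>0 \<and> linear_map_on T G \<Gamma>\<^sub>1 \<and>
    G \<times> G \<subseteq> closure ((\<lambda>f. (\<Gamma>\<^sub>0 f, \<Gamma>\<^sub>1 f)) ` T) \<and>
    self_adjoint_relation H (map_ker T \<Gamma>\<^sub>0) \<and>
    (\<forall>f\<in>T. \<forall>g\<in>T. cinner (snd f) (fst g) - cinner (fst f) (snd g) =
      cinner (\<Gamma>\<^sub>1 f) (\<Gamma>\<^sub>0 g) - cinner (\<Gamma>\<^sub>0 f) (\<Gamma>\<^sub>1 g))"

definition restriction_by ::
    "('a \<times> 'a :: complex_inner) set \<Rightarrow> ('a \<times> 'a \<Rightarrow> 'a) \<Rightarrow> ('a \<times> 'a \<Rightarrow> 'a) \<Rightarrow>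
     ('a \<times> 'a) set \<Rightarrow> ('a \<times> 'a) set"
  where "restriction_by T \<Gamma>\<^sub>0 \<Gamma>\<^sub>1 \<Theta> = {f \<in> T. (\<Gamma>\<^sub>0 f, \<Gamma>\<^sub>1 f) \<in> \<Theta>}"

definition defect_space :: "('a \<times> 'a :: complex_inner) set \<Rightarrow> complex \<Rightarrow> ('a \<times> 'a) set"
  where "defect_space T \<mu> = {(f, \<mu> *\<^sub>C f) | f. f \<in> rel_ker (rel_shift T \<mu>)}"

text \<open>
  The \<open>\<gamma>\<close>-field and the Weyl function: the graphs of the first projection, respectively \<open>\<Gamma>\<^sub>1\<close>, after
  the inverse of the restriction of \<open>\<Gamma>\<^sub>0\<close> to the defect space. They are operators defined on the
  range of \<open>\<Gamma>\<^sub>0\<close> for \<open>\<mu>\<close> in the resolvent set of the kernel of \<open>\<Gamma>\<^sub>0\<close>.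
\<close>

definition gamma_field ::
    "('a \<times> 'a :: complex_inner) set \<Rightarrow> ('a \<times> 'a \<Rightarrow> 'a) \<Rightarrow> complex \<Rightarrow> ('a \<times> 'a) set"
  where "gamma_field T \<Gamma>\<^sub>0 \<mu> = {(\<Gamma>\<^sub>0 f, fst f) | f. f \<in> defect_space T \<mu>}"

definition weyl_function ::
    "('a \<times> 'a :: complex_inner) set \<Rightarrow> ('a \<times> 'a \<Rightarrow> 'a) \<Rightarrow> ('a \<times> 'a \<Rightarrow> 'a) \<Rightarrow> complex \<Rightarrow> ('a \<times> 'a) set"
  where "weyl_function T \<Gamma>\<^sub>0 \<Gamma>\<^sub>1 \<mu> = {(\<Gamma>\<^sub>0 f, \<Gamma>\<^sub>1 f) | f. f \<in> defect_space T \<mu>}"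

end

theory Submission
  imports Defs
begin

text \<open>
  At the nonreal point \<open>\<mu>\<^sub>0\<close>, which lies in both resolvent sets, put \<open>B h = \<Gamma>\<^sub>0 f\<close> and \<open>C h = \<Gamma>\<^sub>1 g\<close>, where
  \<open>f \<in> A\<^sub>\<Theta>\<close> and \<open>g \<in> A\<^sub>0\<close> are the elements whose first components are the resolvents applied to \<open>h\<close>. Then
  the difference of the resolvents is \<open>\<gamma>(\<mu>\<^sub>0) B\<close>, and \<open>(B h, C h) \<in> \<Theta> - M(\<mu>\<^sub>0)\<close>. Green's identity shows
  that \<open>C\<close> is closed, hence bounded by the closed graph theorem. As the closure of \<open>\<Theta> - M(\<mu>\<^sub>0)\<close> is
  injective, \<open>B\<close> is then closed as well, hence bounded. Since \<open>\<gamma>(\<mu>\<^sub>1)\<close> is contained in some \<open>X\<close> in the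
  ideal, \<open>\<gamma>(\<mu>\<^sub>0) = (I + (\<mu>\<^sub>0 - \<mu>\<^sub>1) (A\<^sub>0 - \<mu>\<^sub>0)\<^sup>-\<^sup>1) \<gamma>(\<mu>\<^sub>1)\<close> gives the claim at \<open>\<mu>\<^sub>0\<close>, and resolvent identities
  carry it over to every other point.

  The ideal property may only be used for separable spaces. \<open>G\<close> is separable because \<open>(\<Gamma>\<^sub>0, \<Gamma>\<^sub>1)\<close> is
  closable with dense range: the closure of its graph projects injectively into \<open>H \<times> H\<close>, hence is
  separable.
\<close>

section \<open>Complex inner products\<close>

lemma cinner_add_right: "cinner x (y + z) = cinner x y + cinner x z"
  by (metis cinner_add_left cinner_commute complex_cnj_add)

lemma cinner_scaleC_right: "cinner x (c *\<^sub>C y) = cnj c * cinner x y"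
  by (metis cinner_commute cinner_scaleC_left complex_cnj_mult)

lemma cinner_diff_left: "cinner (x - y) z = cinner x z - cinner y z"
  by (metis add_diff_cancel_right' cinner_add_left diff_add_cancel)

lemma cinner_diff_right: "cinner x (y - z) = cinner x y - cinner x z"
  by (metis add_diff_cancel_right' cinner_add_right diff_add_cancel)

lemma cinner_zero_left [simp]: "cinner 0 x = 0"
  by (metis cinner_diff_left diff_self)

lemma cinner_zero_right [simp]: "cinner x 0 = 0"
  by (metis cinner_diff_right diff_self)

lemma cinner_minus_left: "cinner (- x) y = - cinner x y"
  using cinner_diff_left[of 0 x y] by simp

lemma cinner_self: "cinner x x = complex_of_real ((norm x)\<^sup>2)"
proof (rule complex_eqI)
  show "Re (cinner x x) = Re (complex_of_real ((norm x)\<^sup>2))"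
    by (simp add: inner_eq_Re_cinner[symmetric] power2_norm_eq_inner)
  have "Im (cinner x x) = - Im (cinner x x)"
    by (metis cinner_commute cnj.simps(2))
  then show "Im (cinner x x) = Im (complex_of_real ((norm x)\<^sup>2))"
    by simp
qed

lemma cinner_self_eq_0 [simp]: "cinner x x = 0 \<longleftrightarrow> x = 0"
  by (simp add: cinner_self)

lemma cinner_eq_0_commute: "cinner x y = 0 \<longleftrightarrow> cinner y x = 0"
  by (metis cinner_commute complex_cnj_zero)

lemma norm_scaleC: "norm (c *\<^sub>C x) = norm c * norm x"
proof -
  have "cinner (c *\<^sub>C x) (c *\<^sub>C x) = (c * cnj c) * cinner x x"
    by (simp add: cinner_scaleC_left cinner_scaleC_right)
  then have "complex_of_real ((norm (c *\<^sub>C x))\<^sup>2) = complex_of_real ((norm c * norm x)\<^sup>2)"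
    unfolding cinner_self complex_norm_square[symmetric] by (simp add: power_mult_distrib)
  then have "(norm (c *\<^sub>C x))\<^sup>2 = (norm c * norm x)\<^sup>2"
    using of_real_eq_iff by blast
  then show ?thesis
    by simp
qed

text \<open>This reduces statements about the complex inner product to real inner products, where
  the library's limit and orthogonality results apply.\<close>

lemma Im_cinner: "Im (cinner x y) = inner x (\<i> *\<^sub>C y)"
  by (simp add: inner_eq_Re_cinner cinner_scaleC_right)

lemma norm_cinner_le: "norm (cinner x y) \<le> norm x * norm y"
proof (cases "cinner x y = 0")
  case False
  \<comment> \<open>Multiplying \<open>x\<close> by this unimodular factor makes its inner product
    with \<open>y\<close> real and nonnegative, so the real Cauchy-Schwarz inequality
    suffices.\<close>
  let ?c = "cnj (sgn (cinner x y))"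
  have "?c * cinner x y = cinner x y * cnj (cinner x y) / complex_of_real (norm (cinner x y))"
    by (simp add: sgn_eq)
  also have "\<dots> = complex_of_real (norm (cinner x y))"
    unfolding complex_norm_square[symmetric] using False by (simp add: power2_eq_square)
  finally have "complex_of_real (norm (cinner x y)) = cinner (?c *\<^sub>C x) y"
    by (simp add: cinner_scaleC_left)
  then have "norm (cinner x y) = inner (?c *\<^sub>C x) y"
    by (metis inner_eq_Re_cinner Re_complex_of_real)
  also have "\<dots> \<le> norm (?c *\<^sub>C x) * norm y"
    by (rule norm_cauchy_schwarz)
  also have "\<dots> = norm x * norm y"
    using False by (simp add: norm_scaleC norm_sgn)
  finally show ?thesis .
qed simp

lemma tendsto_scaleC:
  fixes l :: "'a :: complex_inner"
  shows "(f \<longlongrightarrow> l) F \<Longrightarrow> ((\<lambda>x. c *\<^sub>C f x) \<longlongrightarrow> c *\<^sub>C l) F"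
proof -
  have "bounded_linear (\<lambda>x. c *\<^sub>C x :: 'a)"
    by (rule bounded_linear_intro[of _ "norm c"])
      (simp_all add: scaleC_add_right norm_scaleC scaleC_of_real[symmetric] scaleC_scaleC mult.commute)
  then show "(f \<longlongrightarrow> l) F \<Longrightarrow> ((\<lambda>x. c *\<^sub>C f x) \<longlongrightarrow> c *\<^sub>C l) F"
    by (rule bounded_linear.tendsto)
qed

lemma tendsto_cinner:
  assumes "(f \<longlongrightarrow> a) F" "(g \<longlongrightarrow> b) F"
  shows "((\<lambda>x. cinner (f x) (g x)) \<longlongrightarrow> cinner a b) F"
  unfolding tendsto_complex_iff inner_eq_Re_cinner[symmetric] Im_cinner
  using assms by (auto intro!: tendsto_inner tendsto_scaleC)

lemma scaleC_diff_right: "c *\<^sub>C (x - y) = c *\<^sub>C x - c *\<^sub>C y"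
  by (rule complex_vector.scale_right_diff_distrib)

section \<open>Closures and products of complex subspaces\<close>

lemma csubspace_closure:
  assumes "csubspace S"
  shows "csubspace (closure S)"
  unfolding complex_vector.subspace_def
proof (intro conjI ballI allI)
  show "0 \<in> closure S"
    using assms closure_subset complex_vector.subspace_0 by blast
  fix c x assume "x \<in> closure S"
  then obtain s where s: "\<And>n. s n \<in> S" "s \<longlonglongrightarrow> x"
    by (auto simp: closure_sequential)
  show "c *\<^sub>C x \<in> closure S"
    unfolding closure_sequential
    by (rule exI[of _ "\<lambda>n. c *\<^sub>C s n"]) (simp add: s assms complex_vector.subspace_scale tendsto_scaleC)
  fix y assume "y \<in> closure S"
  then obtain t where t: "\<And>n. t n \<in> S" "t \<longlonglongrightarrow> y"
    by (auto simp: closure_sequential)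
  show "x + y \<in> closure S"
    unfolding closure_sequential
    by (rule exI[of _ "\<lambda>n. s n + t n"])
      (simp add: s t assms complex_vector.subspace_add tendsto_add)
qed

lemma csubspace_Times: "csubspace A \<Longrightarrow> csubspace B \<Longrightarrow> csubspace (A \<times> B)"
  by (auto simp: complex_vector.subspace_def scaleC_prod_def zero_prod_def)

lemma csubspace_scaleR: "csubspace S \<Longrightarrow> x \<in> S \<Longrightarrow> r *\<^sub>R x \<in> S"
  by (metis complex_vector.subspace_scale scaleC_of_real)

lemma complete_Times:
  fixes A :: "'a :: metric_space set" and B :: "'b :: metric_space set"
  assumes "complete A" "complete B"
  shows "complete (A \<times> B)"
unfolding complete_def
proof (intro allI impI, elim conjE)
  fix s assume s: "\<forall>n. s n \<in> A \<times> B" "Cauchy s"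
  then obtain a b where "a \<in> A" "(\<lambda>n. fst (s n)) \<longlonglongrightarrow> a" "b \<in> B" "(\<lambda>n. snd (s n)) \<longlonglongrightarrow> b"
    by (metis assms completeE Cauchy_fst Cauchy_snd mem_Times_iff)
  then show "\<exists>l\<in>A \<times> B. s \<longlonglongrightarrow> l"
    using tendsto_Pair[of "\<lambda>n. fst (s n)" a sequentially "\<lambda>n. snd (s n)" b] by auto
qed

lemma hilbert_space_Times:
  "hilbert_space A \<Longrightarrow> hilbert_space B \<Longrightarrow> hilbert_space (A \<times> B)"
  by (simp add: hilbert_space_def csubspace_Times complete_Times)

lemma hilbert_space_closed_subset:
  assumes "hilbert_space K" "S \<subseteq> K" "csubspace S" "closed S"
  shows "hilbert_space S"
  using assms complete_closed_subset by (auto simp: hilbert_space_def)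

section \<open>Orthogonal projections\<close>

text \<open>A sequence in \<open>S\<close> minimizing the distance to \<open>x\<close> is Cauchy by
  the parallelogram law. Its limit \<open>q\<close> is a nearest point, and minimality along each
  line through \<open>q\<close> in \<open>S\<close> forces orthogonality.\<close>

lemma hilbert_space_projection:
  assumes S: "hilbert_space S"
  shows "\<exists>q\<in>S. \<forall>s\<in>S. cinner (x - q) s = 0"
proof -
  have sub: "csubspace S" and comp: "complete S"
    using S by (auto simp: hilbert_space_def)
  define d where "d = infdist x S"
  have ne: "S \<noteq> {}"
    using complex_vector.subspace_0[OF sub] by blast
  have "\<exists>s\<in>S. dist x s < d + inverse (Suc n)" for n
    using cInf_lessD[of "dist x ` S" "d + inverse (Suc n)"] ne
    by (auto simp: d_def infdist_def)
  then obtain s where s: "\<And>n. s n \<in> S" "\<And>n. dist x (s n) < d + inverse (Suc n)"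
    by metis
  have d: "d \<le> dist x y" if "y \<in> S" for y
    using that by (simp add: d_def infdist_le)
  have "d \<ge> 0"
    by (simp add: d_def infdist_nonneg)
  \<comment> \<open>The midpoint of \<open>y\<close> and \<open>z\<close> lies in \<open>S\<close>,
    so its distance to \<open>x\<close> is at least \<open>d\<close>. The parallelogram law turns
    this into a bound on the distance of \<open>y\<close> and \<open>z\<close>.\<close>
  have par: "(dist y z)\<^sup>2 \<le> 2 * (dist x y)\<^sup>2 + 2 * (dist x z)\<^sup>2 - 4 * d\<^sup>2" if "y \<in> S" "z \<in> S" for y z
  proof -
    have "(1/2) *\<^sub>R (y + z) \<in> S"
      using that by (intro csubspace_scaleR complex_vector.subspace_add sub)
    then have "d \<le> norm (x - (1/2) *\<^sub>R (y + z))"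
      using d by (simp add: dist_norm)
    then have "4 * d\<^sup>2 \<le> 4 * (norm (x - (1/2) *\<^sub>R (y + z)))\<^sup>2"
      using \<open>d \<ge> 0\<close> by (simp add: power_mono)
    moreover have "4 * (norm (x - (1/2) *\<^sub>R (y + z)))\<^sup>2 + (dist y z)\<^sup>2
        = 2 * (dist x y)\<^sup>2 + 2 * (dist x z)\<^sup>2"
      by (simp add: dist_norm power2_norm_eq_inner inner_diff inner_add algebra_simps inner_commute)
    ultimately show ?thesis by simp
  qed
  have "Cauchy s"
  proof (rule metric_CauchyI)
    fix e :: real assume "e > 0"
    have "(\<lambda>n. 4 * (d + inverse (Suc n))\<^sup>2 - 4 * d\<^sup>2) \<longlonglongrightarrow> 4 * (d + 0)\<^sup>2 - 4 * d\<^sup>2"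
      by (intro tendsto_intros LIMSEQ_inverse_real_of_nat)
    then have "(\<lambda>n. 4 * (d + inverse (Suc n))\<^sup>2 - 4 * d\<^sup>2) \<longlonglongrightarrow> 0"
      by simp
    then have "\<forall>\<^sub>F n in sequentially. 4 * (d + inverse (Suc n))\<^sup>2 - 4 * d\<^sup>2 < e\<^sup>2"
      by (rule order_tendstoD) (use \<open>e > 0\<close> in simp)
    then obtain N where N: "4 * (d + inverse (Suc N))\<^sup>2 - 4 * d\<^sup>2 < e\<^sup>2"
      by (meson eventually_sequentially order_refl)
    have b: "(dist x (s n))\<^sup>2 \<le> (d + inverse (Suc N))\<^sup>2" if "n \<ge> N" for n
    proof (rule power_mono)
      have "inverse (real (Suc n)) \<le> inverse (real (Suc N))"
        using that by (simp add: field_simps)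
      then show "dist x (s n) \<le> d + inverse (Suc N)"
        using s(2)[of n] by linarith
    qed simp
    show "\<exists>M. \<forall>m\<ge>M. \<forall>n\<ge>M. dist (s m) (s n) < e"
    proof (intro exI[of _ N] allI impI)
      fix m n assume "m \<ge> N" "n \<ge> N"
      then have "(dist (s m) (s n))\<^sup>2 < e\<^sup>2"
        using par[OF s(1) s(1), of m n] b[of m] b[of n] N by simp
      then show "dist (s m) (s n) < e"
        using \<open>e > 0\<close> by (simp add: power_less_imp_less_base)
    qed
  qed
  then obtain q where q: "q \<in> S" "s \<longlonglongrightarrow> q"
    using comp s(1) by (metis completeE)
  have "dist x q \<le> d + 0"
  proof (rule tendsto_le[OF sequentially_bot])
    show "(\<lambda>n. dist x (s n)) \<longlonglongrightarrow> dist x q"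
      by (intro tendsto_intros q)
    show "(\<lambda>n. d + inverse (Suc n)) \<longlonglongrightarrow> d + 0"
      by (intro tendsto_intros LIMSEQ_inverse_real_of_nat)
    show "\<forall>\<^sub>F n in sequentially. dist x (s n) \<le> d + inverse (Suc n)"
      by (rule always_eventually) (use s(2) less_imp_le in blast)
  qed
  then have min: "norm (x - q) \<le> norm (x - y)" if "y \<in> S" for y
    using d[OF that] by (simp add: dist_norm)
  have orth: "inner (x - q) t = 0" if "t \<in> S" for t
  proof (cases "t = 0")
    case False
    \<comment> \<open>This is the minimizer of the norm of \<open>x - q - r t\<close> over real
      \<open>r\<close>. Comparison with the minimality of \<open>q\<close> leaves no room for a
      nonzero inner product.\<close>
    define r where "r = inner (x - q) t / inner t t"
    have "q + r *\<^sub>R t \<in> S"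
      using q that by (intro complex_vector.subspace_add csubspace_scaleR sub)
    then have "inner (x - q) (x - q) \<le> inner (x - (q + r *\<^sub>R t)) (x - (q + r *\<^sub>R t))"
      using min by (simp add: norm_eq_sqrt_inner)
    also have "\<dots> = inner (x - q) (x - q) - (inner (x - q) t)\<^sup>2 / inner t t"
      using False unfolding r_def
      by (simp add: inner_diff inner_add inner_commute field_simps power2_eq_square)
    finally have "(inner (x - q) t)\<^sup>2 / inner t t \<le> 0"
      by simp
    then show ?thesis
      using False by (metis divide_le_0_iff inner_ge_zero inner_eq_zero_iff zero_eq_power2 zero_le_power2 order_antisym)
  qed simp
  \<comment> \<open>So far only the real part is known to vanish. Since \<open>S\<close> is a
    complex subspace, the imaginary part follows by replacing \<open>t\<close> with its multiple by
    the imaginary unit.\<close>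
  have "cinner (x - q) t = 0" if "t \<in> S" for t
  proof (rule complex_eqI)
    show "Re (cinner (x - q) t) = Re 0"
      using orth[OF that] by (simp add: inner_eq_Re_cinner)
    show "Im (cinner (x - q) t) = Im 0"
      using orth[OF complex_vector.subspace_scale[OF sub that]] by (simp add: Im_cinner)
  qed
  then show ?thesis
    using q(1) by blast
qed

text \<open>The difference of \<open>x\<close> and its projection onto \<open>S\<close> lies in
  \<open>K\<close> and is orthogonal to \<open>S\<close>, hence is zero.\<close>

lemma hilbert_subspace_eqI:
  assumes "hilbert_space S" "csubspace K" "S \<subseteq> K"
    and "\<And>x. x \<in> K \<Longrightarrow> (\<And>s. s \<in> S \<Longrightarrow> cinner x s = 0) \<Longrightarrow> x = 0"
  shows "S = K"
proof
  show "K \<subseteq> S"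
  proof
    fix x assume x: "x \<in> K"
    obtain q where q: "q \<in> S" "\<And>s. s \<in> S \<Longrightarrow> cinner (x - q) s = 0"
      using hilbert_space_projection[OF assms(1)] by blast
    then have "x - q = 0"
      using assms x by (meson complex_vector.subspace_diff subsetD)
    then show "x \<in> S"
      using q(1) by simp
  qed
qed fact

text \<open>By continuity of the inner product. It is applied with \<open>y = x\<close> to show that
  a vector in the closure of a set orthogonal to it is zero.\<close>

lemma cinner_closure_eq_0:
  assumes "\<And>s. s \<in> S \<Longrightarrow> cinner x s = 0" "y \<in> closure S"
  shows "cinner x y = 0"
proof -
  obtain t where t: "\<And>n. t n \<in> S" "t \<longlonglongrightarrow> y"
    using assms(2) by (auto simp: closure_sequential)
  have "(\<lambda>n. cinner x (t n)) \<longlonglongrightarrow> cinner x y"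
    by (intro tendsto_cinner tendsto_const t)
  then show ?thesis
    using assms(1) t(1) by (simp add: LIMSEQ_const_iff)
qed

section \<open>The closed graph theorem\<close>

text \<open>This makes the Baire category theorem available for a Hilbert space that is merely a
  complete subset of the ambient type.\<close>

lemma completely_metrizable_space_complete:
  fixes S :: "'a :: metric_space set"
  assumes "complete S"
  shows "completely_metrizable_space (top_of_set S)"
proof -
  interpret Submetric UNIV dist S
    by unfold_locales simp
  have "sub.mcomplete"
    unfolding sub.mcomplete_def
  proof (intro allI impI)
    fix \<sigma> assume \<sigma>: "sub.MCauchy \<sigma>"
    then have S: "\<And>n. \<sigma> n \<in> S" and "Cauchy \<sigma>"
      by (auto simp: sub.MCauchy_def Cauchy_def)
    then obtain l where "l \<in> S" "\<sigma> \<longlonglongrightarrow> l"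
      using assms by (metis completeE)
    then have "limitin sub.mtopology \<sigma> l sequentially"
      using S by (simp add: mtopology_submetric limitin_subtopology)
    then show "\<exists>l. limitin sub.mtopology \<sigma> l sequentially"
      by blast
  qed
  then show ?thesis
    by (metis sub.completely_metrizable_space_mtopology mtopology_submetric mtopology_is_euclidean)
qed

text \<open>Baire's theorem provides a ball of \<open>H\<close> on which arguments can be
  approximated by arguments with uniformly bounded values. Repeatedly approximating the remainder
  gives a convergent series of values, and closedness of the graph identifies its sum.\<close>

lemma closed_graph_theorem:
  assumes H: "hilbert_space H" and G: "hilbert_space G" and B: "linear_relation H G B"
    and ex1: "\<And>x. x \<in> H \<Longrightarrow> \<exists>!y. (x, y) \<in> B"
    and lim: "\<And>s t x y. (\<And>n. (s n, t n) \<in> B) \<Longrightarrow> s \<longlonglongrightarrow> x \<Longrightarrow> t \<longlonglongrightarrow> y \<Longrightarrow> x \<in> H \<Longrightarrow> y \<in> G \<Longrightarrow> (x, y) \<in> B"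
  shows "B \<in> bounded_ops H G"
proof -
  have H': "csubspace H" "complete H" and G': "csubspace G" "complete G"
    using H G by (auto simp: hilbert_space_def)
  have BS: "csubspace B" and BHG: "B \<subseteq> H \<times> G"
    using B by (auto simp: linear_relation_def)
  define E where "E n = closure {x \<in> H. \<exists>y. (x, y) \<in> B \<and> norm y \<le> real n}" for n
  have cl: "closed H"
    using H'(2) by (rule complete_imp_closed)
  have EH: "E n \<subseteq> H" for n
    unfolding E_def by (rule closure_minimal) (use cl in auto)
  have "H \<subseteq> \<Union> (range E)"
  proof
    fix x assume "x \<in> H"
    then obtain y where "(x, y) \<in> B"
      using ex1 by blast
    moreover obtain n where "norm y \<le> real n"
      using real_arch_simple by blast
    ultimately have "x \<in> {x \<in> H. \<exists>y. (x, y) \<in> B \<and> norm y \<le> real n}"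
      using \<open>x \<in> H\<close> by blast
    then have "x \<in> E n"
      unfolding E_def by (rule subsetD[OF closure_subset])
    then show "x \<in> \<Union> (range E)"
      by blast
  qed
  then have UN: "\<Union> (range E) = H"
    using EH by blast
  \<comment> \<open>The closed sets \<open>E n\<close> cover \<open>H\<close>. If all had empty
    interior in \<open>H\<close>, then so would \<open>H\<close> itself, although it contains
    \<open>0\<close>.\<close>
  have "\<exists>N. (top_of_set H) interior_of (E N) \<noteq> {}"
  proof (rule ccontr)
    assume "\<nexists>N. (top_of_set H) interior_of (E N) \<noteq> {}"
    then have "(top_of_set H) interior_of \<Union> (range E) = {}"
      using EH by (intro Baire_category_alt disjI1 completely_metrizable_space_complete H')
        (auto simp: E_def intro!: closed_subset)
    moreover have "(top_of_set H) interior_of H = H"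
      by (metis interior_of_topspace topspace_euclidean_subtopology)
    ultimately show False
      using UN complex_vector.subspace_0[OF H'(1)] by auto
  qed
  then obtain N x0 where "x0 \<in> (top_of_set H) interior_of (E N)"
    by blast
  then obtain U where U: "openin (top_of_set H) U" "x0 \<in> U" "U \<subseteq> E N"
    by (auto simp: interior_of_def)
  then have x0: "x0 \<in> H"
    using EH by blast
  obtain r where r: "r > 0" "ball x0 r \<inter> H \<subseteq> U"
    using U(1,2) unfolding openin_contains_ball by blast
  have EB: "\<exists>v w. (v, w) \<in> B \<and> norm w \<le> real N \<and> dist v z < e" if "z \<in> E N" "e > 0" for z e
  proof -
    have "\<forall>e>0. \<exists>v\<in>{x \<in> H. \<exists>y. (x, y) \<in> B \<and> norm y \<le> real N}. dist v z < e"
      using that(1) by (simp only: E_def closure_approachable)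
    then have "\<exists>v\<in>{x \<in> H. \<exists>y. (x, y) \<in> B \<and> norm y \<le> real N}. dist v z < e"
      using that(2) by (elim allE[of _ e] impE)
    then obtain v w where "(v, w) \<in> B" "norm w \<le> real N" "dist v z < e"
      by (elim bexE CollectE conjE exE)
    then show ?thesis
      by (intro exI conjI)
  qed
  \<comment> \<open>Both \<open>x0 + u\<close> and \<open>x0 - u\<close> lie in \<open>E N\<close>.
    Half the difference of approximations to them approximates \<open>u\<close>, which moves the
    ball from \<open>x0\<close> to the origin without enlarging the bound \<open>N\<close>.\<close>
  have near: "\<exists>v w. (v, w) \<in> B \<and> norm (u - v) < e \<and> norm w \<le> real N"
    if "u \<in> H" "norm u < r" "e > 0" for u e
  proof -
    have "x0 + u \<in> H" "x0 - u \<in> H"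
      using that x0 H'(1) by (auto intro: complex_vector.subspace_add complex_vector.subspace_diff)
    then have "x0 + u \<in> E N" "x0 - u \<in> E N"
      using r U(3) that by (auto simp: dist_norm subset_iff)
    then obtain v1 v2 w1 w2 where v: "(v1, w1) \<in> B" "norm w1 \<le> N" "dist v1 (x0 + u) < e"
      "(v2, w2) \<in> B" "norm w2 \<le> N" "dist v2 (x0 - u) < e"
      using EB \<open>e > 0\<close> by metis
    have "(1/2) *\<^sub>R ((v1, w1) - (v2, w2)) \<in> B"
      by (intro csubspace_scaleR complex_vector.subspace_diff BS v)
    then have 1: "((1/2) *\<^sub>R (v1 - v2), (1/2) *\<^sub>R (w1 - w2)) \<in> B"
      by simp
    have "u - (1/2) *\<^sub>R (v1 - v2) = (1/2) *\<^sub>R ((x0 + u - v1) - (x0 - u - v2))"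
      by (simp add: algebra_simps)
        (simp add: scaleR_left.add[symmetric])
    then have "norm (u - (1/2) *\<^sub>R (v1 - v2)) = 1/2 * norm ((x0 + u - v1) - (x0 - u - v2))"
      by (metis norm_scaleR abs_of_pos half_gt_zero_iff zero_less_one)
    also have "\<dots> \<le> 1/2 * (dist v1 (x0 + u) + dist v2 (x0 - u))"
      using norm_triangle_ineq4[of "x0 + u - v1" "x0 - u - v2"] by (simp add: dist_norm norm_minus_commute)
    also have "\<dots> < e"
      using v by simp
    finally have 2: "norm (u - (1/2) *\<^sub>R (v1 - v2)) < e" .
    have "norm ((1/2) *\<^sub>R (w1 - w2)) \<le> N"
      using norm_triangle_ineq4[of w1 w2] v by simp
    with 1 2 show ?thesis
      by blast
  qed
  \<comment> \<open>The bound \<open>N\<close> on the ball of radius \<open>r\<close>, rescaled to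
    all of \<open>H\<close>; the factor \<open>2\<close> comes from scaling vectors to norm
    \<open>r / 2\<close>, strictly inside that ball.\<close>
  define C where "C = 2 * real N / r"
  have C: "C \<ge> 0"
    using r by (simp add: C_def)
  have approx: "\<exists>v w. (v, w) \<in> B \<and> norm (u - v) \<le> norm u / 2 \<and> norm w \<le> C * norm u" if "u \<in> H" for u
  proof (cases "u = 0")
    case True
    then show ?thesis
      using complex_vector.subspace_0[OF BS] by (intro exI[of _ 0]) (simp add: zero_prod_def)
  next
    case False
    define k where "k = r / (2 * norm u)"
    have k: "k > 0"
      using False r by (simp add: k_def)
    have ku: "norm (k *\<^sub>R u) < r"
      using False r by (simp add: k_def)
    obtain v w where v: "(v, w) \<in> B" "norm (k *\<^sub>R u - v) < k * (norm u / 2)" "norm w \<le> N"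
      using near[of "k *\<^sub>R u" "k * (norm u / 2)"] csubspace_scaleR[OF H'(1) \<open>u \<in> H\<close>] False k ku by auto
    have "u - inverse k *\<^sub>R v = inverse k *\<^sub>R (k *\<^sub>R u - v)"
      using k by (simp add: scaleR_diff_right)
    then have "norm (u - inverse k *\<^sub>R v) = inverse k * norm (k *\<^sub>R u - v)"
      using k by simp
    also have "\<dots> \<le> norm u / 2"
      using v(2) k by (simp add: field_simps)
    finally have 1: "norm (u - inverse k *\<^sub>R v) \<le> norm u / 2" .
    have "norm (inverse k *\<^sub>R w) \<le> inverse k * N"
      using k v(3) by (simp add: field_simps)
    also have "\<dots> = C * norm u"
      using False r by (simp add: k_def C_def field_simps)
    finally have "norm (inverse k *\<^sub>R w) \<le> C * norm u" .
    moreover have "(inverse k *\<^sub>R v, inverse k *\<^sub>R w) \<in> B"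
      using csubspace_scaleR[OF BS v(1)] by simp
    ultimately show ?thesis
      using 1 by blast
  qed
  have bound: "norm y \<le> 2 * C * norm x" if xy: "(x, y) \<in> B" for x y
  proof -
    have x: "x \<in> H"
      using xy BHG by blast
    obtain v w where vw: "\<And>u. u \<in> H \<Longrightarrow> (v u, w u) \<in> B" "\<And>u. u \<in> H \<Longrightarrow> norm (u - v u) \<le> norm u / 2"
      "\<And>u. u \<in> H \<Longrightarrow> norm (w u) \<le> C * norm u"
      using approx by metis
    \<comment> \<open>The remainders of successive approximation: each is at most half as long as
      the previous one. The approximants telescope to \<open>x - u n\<close>, and \<open>W n\<close>
      is the sum of the corresponding values.\<close>
    define u where "u n = ((\<lambda>z. z - v z) ^^ n) x" for n
    have u0: "u 0 = x" and uS: "\<And>n. u (Suc n) = u n - v (u n)"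
      by (simp_all add: u_def)
    have uH: "u n \<in> H" for n
    proof (induction n)
      case (Suc n)
      then show ?case
        using vw(1)[OF Suc] BHG H'(1) by (auto simp: uS intro: complex_vector.subspace_diff)
    qed (simp add: u0 x)
    have un: "norm (u n) \<le> norm x * (1/2) ^ n" for n
    proof (induction n)
      case (Suc n)
      then show ?case
        using vw(2)[OF uH[of n]] by (simp add: uS)
    qed (simp add: u0)
    define W where "W n = (\<Sum>k<n. w (u k))" for n
    have sB: "(x - u n, W n) \<in> B" for n
    proof (induction n)
      case 0
      then show ?case
        using complex_vector.subspace_0[OF BS] by (simp add: u0 W_def zero_prod_def)
    next
      case (Suc n)
      then show ?case
        using complex_vector.subspace_add[OF BS Suc vw(1)[OF uH[of n]]]
        by (simp add: uS W_def algebra_simps)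
    qed
    have geo: "(\<lambda>n. C * norm x * (1/2) ^ n) sums (C * norm x * 2)"
      using sums_mult[OF geometric_sums[of "1/2 :: real"], of "C * norm x"] by simp
    have wn: "norm (w (u n)) \<le> C * norm x * (1/2) ^ n" for n
      using vw(3)[OF uH[of n]] mult_left_mono[OF un C, of n] by (simp add: mult.assoc)
    have "Cauchy W"
    proof (rule metric_CauchyI)
      fix e :: real assume "e > 0"
      have "summable (\<lambda>n. norm (w (u n)))"
        by (rule summable_comparison_test[OF _ sums_summable[OF geo]]) (use wn in auto)
      then obtain M where M: "\<And>m n. m \<ge> M \<Longrightarrow> norm (\<Sum>k\<in>{m..<n}. norm (w (u k))) < e"
        using \<open>e > 0\<close> unfolding summable_Cauchy by blast
      have *: "dist (W m) (W n) < e" if "M \<le> m" "m \<le> n" for m n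
      proof -
        have "W n - W m = (\<Sum>k\<in>{m..<n}. w (u k))"
          unfolding W_def using that(2) by (metis sum_diff_nat_ivl atLeast0LessThan le0)
        then have "norm (W n - W m) \<le> (\<Sum>k\<in>{m..<n}. norm (w (u k)))"
          by (simp add: norm_sum)
        then show ?thesis
          using M[OF that(1), of n] by (simp add: dist_norm norm_minus_commute)
      qed
      show "\<exists>M. \<forall>m\<ge>M. \<forall>n\<ge>M. dist (W m) (W n) < e"
        using * by (metis dist_commute linorder_le_cases)
    qed
    moreover have "W n \<in> G" for n
      using sB[of n] BHG by blast
    ultimately obtain z where z: "z \<in> G" "W \<longlonglongrightarrow> z"
      using G'(2) by (metis completeE)
    have "(\<lambda>n. norm x * (1/2) ^ n) \<longlonglongrightarrow> norm x * 0"
      by (intro tendsto_intros LIMSEQ_power_zero) simp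
    then have "u \<longlonglongrightarrow> 0"
      by (intro Lim_null_comparison[of u "\<lambda>n. norm x * (1/2) ^ n"]) (use un in auto)
    then have "(\<lambda>n. x - u n) \<longlonglongrightarrow> x - 0"
      by (intro tendsto_intros)
    \<comment> \<open>The arguments \<open>x - u n\<close> tend to \<open>x\<close> and the values
      \<open>W n\<close> to \<open>z\<close>, so closedness applies. Uniqueness of values gives
      \<open>z = y\<close>, and the geometric bound on \<open>W n\<close> passes to the
      limit.\<close>
    then have "(x, z) \<in> B"
      using lim[of "\<lambda>n. x - u n" W, OF sB] z x by simp
    then have "y = z"
      using ex1[OF x] xy by blast
    have "norm (W n) \<le> C * norm x * 2" for n
    proof -
      have "norm (W n) \<le> (\<Sum>k<n. C * norm x * (1/2) ^ k)"
        unfolding W_def by (rule sum_norm_le) (use wn in auto)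
      also have "\<dots> \<le> C * norm x * 2"
        using sum_le_suminf[OF sums_summable[OF geo], of "{..<n}"] C sums_unique[OF geo] by simp
      finally show ?thesis .
    qed
    then have "norm z \<le> C * norm x * 2"
      by (intro LIMSEQ_le_const2[OF tendsto_norm[OF z(2)]]) auto
    then show ?thesis
      using \<open>y = z\<close> by simp
  qed
  show ?thesis
    unfolding bounded_ops_def using B ex1 bound by blast
qed

section \<open>Linear relations\<close>

text \<open>Boundedness makes the graph closed in the product of the two spaces. This allows
  orthogonal projection onto the graph.\<close>

lemma bounded_ops_hilbert_graph:
  assumes "hilbert_space H" "hilbert_space K" "B \<in> bounded_ops H K"
  shows "hilbert_space B"
proof -
  have sub: "csubspace B" "B \<subseteq> H \<times> K" and ex: "\<And>x. x \<in> H \<Longrightarrow> \<exists>!y. (x, y) \<in> B"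
    using assms(3) by (auto simp: bounded_ops_def linear_relation_def)
  obtain c where c: "\<And>x y. (x, y) \<in> B \<Longrightarrow> norm y \<le> c * norm x"
    using assms(3) unfolding bounded_ops_def by blast
  have "closed B"
    unfolding closed_sequential_limits
  proof (intro allI impI, elim conjE)
    fix s l assume s: "\<forall>n. s n \<in> B" "s \<longlonglongrightarrow> l"
    have f: "(\<lambda>n. fst (s n)) \<longlonglongrightarrow> fst l" and g: "(\<lambda>n. snd (s n)) \<longlonglongrightarrow> snd l"
      using s(2) by (auto intro: tendsto_fst tendsto_snd)
    have "closed H"
      using assms(1) by (simp add: hilbert_space_def complete_imp_closed)
    then have "fst l \<in> H"
      using f s(1) sub(2) by (metis closed_sequentially mem_Times_iff subsetD)
    then obtain y where y: "(fst l, y) \<in> B"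
      using ex by blast
    have "(fst (s n) - fst l, snd (s n) - y) \<in> B" for n
      using complex_vector.subspace_diff[OF sub(1) _ y, of "s n"] s(1)
      by (metis diff_Pair prod.collapse)
    then have le: "norm (snd (s n) - y) \<le> c * norm (fst (s n) - fst l)" for n
      using c by blast
    have "(\<lambda>n. c * norm (fst (s n) - fst l)) \<longlonglongrightarrow> c * norm (fst l - fst l)"
      by (intro tendsto_intros f)
    then have lim0: "(\<lambda>n. c * norm (fst (s n) - fst l)) \<longlonglongrightarrow> 0"
      by simp
    have "(\<lambda>n. snd (s n) - y) \<longlonglongrightarrow> 0"
      by (rule Lim_null_comparison[OF always_eventually[OF allI[OF le]] lim0])
    then have "snd l = y"
      using LIMSEQ_unique[OF g] by (simp add: LIM_zero_iff)
    then show "l \<in> B"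
      using y by (metis prod.collapse)
  qed
  then show ?thesis
    using hilbert_space_closed_subset[OF hilbert_space_Times[OF assms(1,2)] sub(2,1)] by blast
qed

text \<open>The pair \<open>(x, y)\<close> is orthogonal to the orthogonal complement of the closed graph \<open>X\<close>,
  since this complement is the adjoint of \<open>X\<close> up to a rotation.\<close>

lemma mem_bounded_ops_if_adjoint:
  assumes H: "hilbert_space H" and K: "hilbert_space K" and X: "X \<in> bounded_ops H K"
    and "x \<in> H" "y \<in> K"
    and adj: "\<And>g g'. (g, g') \<in> rel_adj H K X \<Longrightarrow> cinner y g = cinner x g'"
  shows "(x, y) \<in> X"
proof -
  have XHK: "X \<subseteq> H \<times> K"
    using X by (auto simp: bounded_ops_def linear_relation_def)
  obtain q where q: "q \<in> X" "\<And>s. s \<in> X \<Longrightarrow> cinner ((x, y) - q) s = 0"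
    using hilbert_space_projection[OF bounded_ops_hilbert_graph[OF H K X]] by blast
  \<comment> \<open>The pair \<open>(a, b)\<close> is the component of \<open>(x, y)\<close>
    orthogonal to \<open>X\<close>. It will turn out to be orthogonal to both \<open>(x, y)\<close>
    and \<open>q\<close>, hence to itself.\<close>
  obtain a b where ab: "(x, y) - q = (a, b)"
    by fastforce
  have "(x, y) - q \<in> H \<times> K"
    using q(1) XHK assms(4,5) H K
    by (intro complex_vector.subspace_diff csubspace_Times) (auto simp: hilbert_space_def)
  then have mem: "a \<in> H" "- a \<in> H" "b \<in> K"
    using ab complex_vector.subspace_neg H by (auto simp: hilbert_space_def)
  have "cinner v b = cinner u (- a)" if "(u, v) \<in> X" for u v
  proof -
    have "cinner (u, v) (a, b) = 0"
      using q(2)[OF that] ab cinner_eq_0_commute by metis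
    then show ?thesis
      using cinner_diff_right[of u 0 a] by (simp add: cinner_prod_def add_eq_0_iff)
  qed
  then have "(b, - a) \<in> rel_adj H K X"
    using mem by (auto simp: rel_adj_def)
  then have "cinner y b = cinner x (- a)"
    by (rule adj)
  then have "cinner (x, y) (a, b) = 0"
    using cinner_diff_right[of x 0 a] by (simp add: cinner_prod_def)
  moreover have "cinner q (a, b) = 0"
    using q ab cinner_eq_0_commute by metis
  ultimately have "cinner (a, b) (a, b) = 0"
    by (metis ab cinner_diff_left diff_zero)
  then have "(x, y) - q = 0"
    using ab by simp
  then show ?thesis
    using q(1) by simp
qed

text \<open>Each defining equation \<open>cinner b g = cinner a g'\<close> is preserved under limits
  of \<open>(g, g')\<close>. In particular a self-adjoint relation is closed.\<close>

lemma closed_rel_adj: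
  assumes "closed H" "closed K"
  shows "closed (rel_adj H K S)"
  unfolding closed_sequential_limits
proof (intro allI impI, elim conjE)
  fix s l assume s: "\<forall>n. s n \<in> rel_adj H K S" "s \<longlonglongrightarrow> l"
  have f: "(\<lambda>n. fst (s n)) \<longlonglongrightarrow> fst l" and g: "(\<lambda>n. snd (s n)) \<longlonglongrightarrow> snd l"
    using s(2) by (auto intro: tendsto_fst tendsto_snd)
  have mem: "fst (s n) \<in> K" "snd (s n) \<in> H"
    and eq: "\<And>a b. (a, b) \<in> S \<Longrightarrow> cinner b (fst (s n)) = cinner a (snd (s n))" for n
    using s(1)[rule_format, of n] by (auto simp: rel_adj_def)
  have "fst l \<in> K" "snd l \<in> H"
    using assms closed_sequentially f g mem by metis+
  moreover have "cinner b (fst l) = cinner a (snd l)" if "(a, b) \<in> S" for a b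
  proof -
    have "(\<lambda>n. cinner b (fst (s n))) \<longlonglongrightarrow> cinner b (fst l)"
      "(\<lambda>n. cinner a (snd (s n))) \<longlonglongrightarrow> cinner a (snd l)"
      by (intro tendsto_cinner f g tendsto_const)+
    then show ?thesis
      using eq[OF that] LIMSEQ_unique by simp
  qed
  ultimately show "l \<in> rel_adj H K S"
    by (auto simp: rel_adj_def split_beta intro!: exI[of _ "fst l"] exI[of _ "snd l"])
qed

section \<open>Resolvents of linear relations\<close>

lemma mem_rel_shift [simp]: "(f, h) \<in> rel_shift S \<mu> \<longleftrightarrow> (f, h + \<mu> *\<^sub>C f) \<in> S"
proof -
  have "(f, h) \<in> rel_shift S \<mu> \<longleftrightarrow> (\<exists>f'. f' = h + \<mu> *\<^sub>C f \<and> (f, f') \<in> S)"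
    by (auto simp: rel_shift_def eq_diff_eq)
  then show ?thesis
    by blast
qed

lemma mem_resolvent: "(h, f) \<in> (rel_shift S \<mu>)\<inverse> \<longleftrightarrow> (f, h + \<mu> *\<^sub>C f) \<in> S"
  by simp

lemma linear_relation_resolvent:
  assumes "csubspace H" "linear_relation H H S"
  shows "linear_relation H H ((rel_shift S \<mu>)\<inverse>)"
proof -
  have S: "csubspace S" "S \<subseteq> H \<times> H"
    using assms(2) by (auto simp: linear_relation_def)
  have "csubspace ((rel_shift S \<mu>)\<inverse>)"
    unfolding complex_vector.subspace_def
  proof (intro conjI ballI allI)
    show "0 \<in> (rel_shift S \<mu>)\<inverse>"
      using complex_vector.subspace_0[OF S(1)] by (simp add: zero_prod_def)
    fix x c assume x: "x \<in> (rel_shift S \<mu>)\<inverse>"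
    then have x': "(snd x, fst x + \<mu> *\<^sub>C snd x) \<in> S"
      by (metis mem_resolvent prod.collapse)
    show "c *\<^sub>C x \<in> (rel_shift S \<mu>)\<inverse>"
      using complex_vector.subspace_scale[OF S(1) x', of c]
      by (simp add: scaleC_prod_def scaleC_add_right scaleC_scaleC mult.commute)
    fix y assume "y \<in> (rel_shift S \<mu>)\<inverse>"
    then have "(snd y, fst y + \<mu> *\<^sub>C snd y) \<in> S"
      by (metis mem_resolvent prod.collapse)
    from complex_vector.subspace_add[OF S(1) x' this] show "x + y \<in> (rel_shift S \<mu>)\<inverse>"
      by (simp add: plus_prod_def scaleC_add_right algebra_simps)
  qed
  moreover have "(rel_shift S \<mu>)\<inverse> \<subseteq> H \<times> H"
  proof
    fix x assume "x \<in> (rel_shift S \<mu>)\<inverse>"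
    then have "(snd x, fst x + \<mu> *\<^sub>C snd x) \<in> S"
      by (metis mem_resolvent prod.collapse)
    then have *: "snd x \<in> H" "fst x + \<mu> *\<^sub>C snd x \<in> H"
      using S(2) by auto
    then have "fst x \<in> H"
      using complex_vector.subspace_diff[OF assms(1) *(2) complex_vector.subspace_scale[OF assms(1) *(1), of \<mu>]]
      by simp
    with * show "x \<in> H \<times> H"
      by (simp add: mem_Times_iff)
  qed
  ultimately show ?thesis
    by (simp add: linear_relation_def)
qed

text \<open>Symmetry bounds the inverse of \<open>S - \<mu>\<close> by the reciprocal of the
  absolute imaginary part of \<open>\<mu>\<close>. With closedness of \<open>S\<close> this makes
  the range closed, and self-adjointness leaves nothing orthogonal to it.\<close>

lemma nonreal_in_resolvent_set:
  assumes H: "hilbert_space H" and S: "self_adjoint_relation H S" and \<mu>: "\<mu> \<notin> \<real>"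
  shows "\<mu> \<in> resolvent_set H S"
proof -
  have H': "csubspace H" "complete H"
    using H by (auto simp: hilbert_space_def)
  have cH: "closed H"
    using H'(2) by (rule complete_imp_closed)
  have lin: "linear_relation H H S" and SS: "S = rel_adj H H S"
    using S by (auto simp: self_adjoint_relation_def)
  have cS: "closed S"
    using closed_rel_adj[OF cH cH] SS by metis
  have sym: "cinner f' g = cinner f g'" if "(f, f') \<in> S" "(g, g') \<in> S" for f f' g g'
  proof -
    have "(g, g') \<in> rel_adj H H S"
      using that(2) SS by simp
    then show ?thesis
      using that(1) by (auto simp: rel_adj_def)
  qed
  define R where "R = (rel_shift S \<mu>)\<inverse>"
  have linR: "linear_relation H H R"
    unfolding R_def by (rule linear_relation_resolvent[OF H'(1) lin])
  then have subR: "csubspace R" and RH: "R \<subseteq> H \<times> H"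
    by (auto simp: linear_relation_def)
  define c where "c = 1 / \<bar>Im \<mu>\<bar>"
  have c: "c > 0"
    using \<mu> by (simp add: c_def complex_is_Real_iff)
  have bound: "norm f \<le> c * norm h" if "(h, f) \<in> R" for h f
  proof (cases "f = 0")
    case False
    have hf: "(f, h + \<mu> *\<^sub>C f) \<in> S"
      using that by (simp add: R_def)
    \<comment> \<open>Pairing an element of a symmetric relation with itself gives a real number, so
      the imaginary part of \<open>cinner h f\<close> comes from the term with \<open>\<mu>\<close>
      alone.\<close>
    have "Im (cinner (h + \<mu> *\<^sub>C f) f) = 0"
      using sym[OF hf hf] cinner_commute[of f "h + \<mu> *\<^sub>C f"] by (metis cnj.simps(2) equal_neg_zero)
    then have "Im (cinner h f) = - Im \<mu> * (norm f)\<^sup>2"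
      by (simp add: cinner_add_left cinner_scaleC_left cinner_self)
    then have "\<bar>Im \<mu>\<bar> * (norm f)\<^sup>2 = \<bar>Im (cinner h f)\<bar>"
      by (simp add: abs_mult)
    also have "\<dots> \<le> norm h * norm f"
      using abs_Im_le_cmod norm_cinner_le order_trans by blast
    finally have "\<bar>Im \<mu>\<bar> * norm f \<le> norm h"
      using False by (simp add: power2_eq_square)
    then show ?thesis
      using c by (simp add: c_def field_simps)
  qed (use c in simp)
  have ran: "{h. \<exists>f. (h, f) \<in> R} = H"
  proof (rule hilbert_subspace_eqI)
    have "{h. \<exists>f. (h, f) \<in> R} = fst ` R"
      by force
    then show 1: "{h. \<exists>f. (h, f) \<in> R} \<subseteq> H"
      using RH by auto
    have 2: "csubspace {h. \<exists>f. (h, f) \<in> R}"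
      unfolding complex_vector.subspace_def
    proof (intro conjI ballI allI)
      show "0 \<in> {h. \<exists>f. (h, f) \<in> R}"
        using complex_vector.subspace_0[OF subR] by (auto simp: zero_prod_def)
      fix x a assume "x \<in> {h. \<exists>f. (h, f) \<in> R}"
      then obtain f where f: "(x, f) \<in> R"
        by blast
      then show "a *\<^sub>C x \<in> {h. \<exists>f. (h, f) \<in> R}"
        using complex_vector.subspace_scale[OF subR f, of a] by (auto simp: scaleC_prod_def)
      fix y assume "y \<in> {h. \<exists>f. (h, f) \<in> R}"
      then obtain g where "(y, g) \<in> R"
        by blast
      from complex_vector.subspace_add[OF subR f this] show "x + y \<in> {h. \<exists>f. (h, f) \<in> R}"
        by auto
    qed
    have 3: "closed {h. \<exists>f. (h, f) \<in> R}"
      unfolding closed_sequential_limits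
    proof (intro allI impI, elim conjE)
      fix s l assume s: "\<forall>n. s n \<in> {h. \<exists>f. (h, f) \<in> R}" "s \<longlonglongrightarrow> l"
      then have "\<forall>n. \<exists>f. (s n, f) \<in> R"
        by simp
      from choice[OF this] obtain f where "\<forall>n. (s n, f n) \<in> R" ..
      then have f: "(s n, f n) \<in> R" for n ..
      \<comment> \<open>The bound, applied to differences, transfers the Cauchy property from
        \<open>s\<close> to its preimages. Closedness of \<open>S\<close> then puts the limit
        \<open>l\<close> into the range.\<close>
      have "Cauchy f"
      proof (rule metric_CauchyI)
        fix e :: real assume "e > 0"
        then obtain M where M: "\<And>m n. m \<ge> M \<Longrightarrow> n \<ge> M \<Longrightarrow> dist (s m) (s n) < e / c"
          using metric_CauchyD[OF LIMSEQ_imp_Cauchy[OF s(2)], of "e / c"] c by auto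
        have "dist (f m) (f n) < e" if "m \<ge> M" "n \<ge> M" for m n
        proof -
          have "(s m - s n, f m - f n) \<in> R"
            using complex_vector.subspace_diff[OF subR f[of m] f[of n]] by simp
          then have "norm (f m - f n) \<le> c * norm (s m - s n)"
            by (rule bound)
          also have "\<dots> < e"
            using M[OF that] c by (simp add: dist_norm field_simps)
          finally show ?thesis
            by (simp add: dist_norm)
        qed
        then show "\<exists>M. \<forall>m\<ge>M. \<forall>n\<ge>M. dist (f m) (f n) < e"
          by blast
      qed
      moreover have "f n \<in> H" for n
        using f[of n] RH by blast
      ultimately obtain g where g: "f \<longlonglongrightarrow> g"
        using H'(2) by (metis completeE)
      have l: "(\<lambda>n. (f n, s n + \<mu> *\<^sub>C f n)) \<longlonglongrightarrow> (g, l + \<mu> *\<^sub>C g)"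
        by (intro tendsto_intros tendsto_scaleC s g)
      have "(f n, s n + \<mu> *\<^sub>C f n) \<in> S" for n
        using f[of n] by (simp add: R_def)
      from closed_sequentially[OF cS this l] have "(g, l + \<mu> *\<^sub>C g) \<in> S" .
      then show "l \<in> {h. \<exists>f. (h, f) \<in> R}"
        by (auto simp: R_def)
    qed
    show "hilbert_space {h. \<exists>f. (h, f) \<in> R}"
      by (rule hilbert_space_closed_subset[OF H 1 2 3])
    show "csubspace H"
      by (rule H')
    fix x assume x: "x \<in> H" and orth: "\<And>s. s \<in> {h. \<exists>f. (h, f) \<in> R} \<Longrightarrow> cinner x s = 0"
    \<comment> \<open>A vector orthogonal to the range of \<open>S - \<mu>\<close> is an eigenvector
      of the adjoint, that is of \<open>S\<close>, for \<open>cnj \<mu>\<close>. Symmetry allows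
      only real eigenvalues, so it vanishes.\<close>
    have "cinner f' x = cinner f (cnj \<mu> *\<^sub>C x)" if "(f, f') \<in> S" for f f'
    proof -
      have "(f' - \<mu> *\<^sub>C f, f) \<in> R"
        using that by (simp add: R_def)
      then have "cinner (f' - \<mu> *\<^sub>C f) x = 0"
        using orth cinner_eq_0_commute by blast
      then show ?thesis
        by (simp add: cinner_diff_left cinner_scaleC_left cinner_scaleC_right)
    qed
    moreover have "cnj \<mu> *\<^sub>C x \<in> H"
      using x H' complex_vector.subspace_scale by blast
    ultimately have "(x, cnj \<mu> *\<^sub>C x) \<in> rel_adj H H S"
      using x by (auto simp: rel_adj_def)
    then have "(x, cnj \<mu> *\<^sub>C x) \<in> S"
      using SS by simp
    from sym[OF this this] have "(cnj \<mu> - \<mu>) * cinner x x = 0"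
      by (simp add: cinner_scaleC_left cinner_scaleC_right algebra_simps)
    moreover have "cnj \<mu> - \<mu> \<noteq> 0"
      using \<mu> by (simp add: Reals_cnj_iff)
    ultimately show "x = 0"
      by simp
  qed
  have "f = g" if "(h, f) \<in> R" "(h, g) \<in> R" for h f g
  proof -
    have "(0, f - g) \<in> R"
      using complex_vector.subspace_diff[OF subR that] by simp
    from bound[OF this] show ?thesis
      by simp
  qed
  moreover have "\<exists>f. (h, f) \<in> R" if "h \<in> H" for h
    using that ran by blast
  ultimately have "\<forall>h\<in>H. \<exists>!f. (h, f) \<in> R"
    by (intro ballI ex_ex1I)
  moreover have "\<exists>c. \<forall>(h, f)\<in>R. norm f \<le> c * norm h"
    using bound by (intro exI[of _ c]) auto
  ultimately have "R \<in> bounded_ops H H"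
    unfolding bounded_ops_def using linR by simp
  then show ?thesis
    by (simp add: resolvent_set_def R_def)
qed

section \<open>Separability\<close>

lemma separable_space_top_of_set:
  "separable_space (top_of_set S) \<longleftrightarrow> (\<exists>C. countable C \<and> C \<subseteq> S \<and> S \<subseteq> closure C)"
proof -
  have "S \<inter> closure (S \<inter> C) = S \<longleftrightarrow> S \<subseteq> closure C" if "C \<subseteq> S" for C
    using that by (simp only: inf.absorb2 inf.absorb_iff1)
  then show ?thesis
    by (auto simp: separable_space_def closure_of_subtopology)
qed

lemma separable_space_Times:
  assumes "separable_space (top_of_set A)" "separable_space (top_of_set B)"
  shows "separable_space (top_of_set (A \<times> B))"
proof -
  obtain C D where "countable C" "C \<subseteq> A" "A \<subseteq> closure C" "countable D" "D \<subseteq> B" "B \<subseteq> closure D"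
    using assms by (auto simp: separable_space_top_of_set)
  then have "countable (C \<times> D) \<and> C \<times> D \<subseteq> A \<times> B \<and> A \<times> B \<subseteq> closure (C \<times> D)"
    by (auto simp: closure_Times)
  then show ?thesis
    unfolding separable_space_top_of_set by blast
qed

text \<open>The image of a countable dense set is dense in the image. A target \<open>T\<close>
  larger than the image is allowed because the range of the boundary map is only dense in
  \<open>G\<close>.\<close>

lemma separable_space_dense_image:
  fixes f :: "'a :: metric_space \<Rightarrow> 'b :: metric_space"
  assumes "separable_space (top_of_set S)" and f: "continuous_on S f"
    and "f ` S \<subseteq> T" "T \<subseteq> closure (f ` S)"
  shows "separable_space (top_of_set T)"
proof -
  obtain C where C: "countable C" "C \<subseteq> S" "S \<subseteq> closure C"
    using assms(1) by (auto simp: separable_space_top_of_set)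
  have "f x \<in> closure (f ` C)" if x: "x \<in> S" for x
  proof -
    obtain s where s: "\<And>n. s n \<in> C" "s \<longlonglongrightarrow> x"
      using subsetD[OF C(3) x] by (auto simp: closure_sequential)
    then have "(\<lambda>n. f (s n)) \<longlonglongrightarrow> f x"
      using f x C(2) unfolding continuous_on_sequentially comp_def by blast
    then show ?thesis
      unfolding closure_sequential by (intro exI[of _ "\<lambda>n. f (s n)"]) (simp add: s(1))
  qed
  then have "closure (f ` S) \<subseteq> closure (f ` C)"
    by (intro closure_minimal) auto
  then show ?thesis
    unfolding separable_space_top_of_set using C assms(3,4)
    by (intro exI[of _ "f ` C"]) (auto simp: image_subset_iff subset_iff)
qed

text \<open>The first projection is injective on \<open>S\<close>, so its adjoint has dense range. The adjoint sends
  \<open>k\<close> to the orthogonal projection of \<open>(k, 0)\<close> onto \<open>S\<close>.\<close>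

lemma separable_space_if_graph:
  assumes S: "hilbert_space S" and K: "hilbert_space K" "separable_space (top_of_set K)"
    and SK: "fst ` S \<subseteq> K" and inj: "\<And>y. (0, y) \<in> S \<Longrightarrow> y = 0"
  shows "separable_space (top_of_set S)"
proof -
  have S': "csubspace S" "closed S" and K': "csubspace K"
    using S K by (auto simp: hilbert_space_def complete_imp_closed)
  obtain p where p: "\<And>x. p x \<in> S" "\<And>x s. s \<in> S \<Longrightarrow> cinner (x - p x) s = 0"
    using hilbert_space_projection[OF S] by metis
  \<comment> \<open>The map \<open>p\<close> was obtained by choice, so its linearity must come from
    uniqueness of the projection: the sum and the multiple are checked against the two properties
    that determine it.\<close>
  have unique: "p x = q" if q: "q \<in> S" "\<And>s. s \<in> S \<Longrightarrow> cinner (x - q) s = 0" for x q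
  proof -
    have "p x - q \<in> S"
      by (intro complex_vector.subspace_diff S' p q)
    then have "cinner (x - q) (p x - q) - cinner (x - p x) (p x - q) = 0"
      using p q by simp
    then have "cinner (p x - q) (p x - q) = 0"
      by (simp add: cinner_diff_left[symmetric])
    then show ?thesis
      by simp
  qed
  have p_add: "p (x + y) = p x + p y" for x y
  proof (rule unique)
    show "p x + p y \<in> S"
      by (intro complex_vector.subspace_add S' p)
    show "cinner (x + y - (p x + p y)) s = 0" if "s \<in> S" for s
      using p(2)[OF that, of x] p(2)[OF that, of y] by (simp add: cinner_diff_left cinner_add_left)
  qed
  have p_scale: "p (c *\<^sub>C x) = c *\<^sub>C p x" for c x
  proof (rule unique)
    show "c *\<^sub>C p x \<in> S"
      by (intro complex_vector.subspace_scale S' p)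
    show "cinner (c *\<^sub>C x - c *\<^sub>C p x) s = 0" if "s \<in> S" for s
      using p(2)[OF that, of x] by (simp add: scaleC_diff_right[symmetric] cinner_scaleC_left)
  qed
  have p_norm: "norm (p x) \<le> norm x" for x
  proof (cases "p x = 0")
    case False
    have "cinner x (p x) = cinner (p x) (p x)"
      using p(2)[OF p(1), of x x] by (simp add: cinner_diff_left)
    then have "norm (p x) * norm (p x) \<le> norm x * norm (p x)"
      using norm_cinner_le[of x "p x"] by (simp add: cinner_self norm_power power2_eq_square norm_mult)
    then show ?thesis
      using False by simp
  qed simp
  have p_diff: "p (x - y) = p x - p y" for x y
    by (metis add_diff_cancel_right' diff_add_cancel p_add)
  define f where "f k = p (k, 0)" for k
  have cont: "continuous_on K f"
  proof (rule continuous_on_iff[THEN iffD2], intro ballI allI impI)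
    fix x e assume "x \<in> K" "(e :: real) > 0"
    moreover have "dist (f y) (f x) \<le> dist y x" for y
      using p_norm[of "(y, 0) - (x, 0)"] unfolding f_def dist_norm p_diff by (simp add: norm_Pair)
    ultimately show "\<exists>d>0. \<forall>y\<in>K. dist y x < d \<longrightarrow> dist (f y) (f x) < e"
      by (meson order_le_less_trans)
  qed
  have sub: "csubspace (f ` K)"
    unfolding complex_vector.subspace_def
  proof (intro conjI ballI allI)
    have "f 0 = 0"
      using p_diff[of 0 0] by (simp add: f_def zero_prod_def)
    then show "0 \<in> f ` K"
      using complex_vector.subspace_0[OF K'] by (metis imageI)
    fix x c assume "x \<in> f ` K"
    then obtain k where k: "k \<in> K" "x = f k"
      by blast
    have "c *\<^sub>C x = f (c *\<^sub>C k)"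
      unfolding k f_def p_scale[symmetric] by (simp add: scaleC_prod_def)
    then show "c *\<^sub>C x \<in> f ` K"
      using complex_vector.subspace_scale[OF K' k(1)] by blast
    fix y assume "y \<in> f ` K"
    then obtain l where l: "l \<in> K" "y = f l"
      by blast
    have "x + y = f (k + l)"
      unfolding k l f_def p_add[symmetric] by simp
    then show "x + y \<in> f ` K"
      using complex_vector.subspace_add[OF K' k(1) l(1)] by blast
  qed
  have fS: "f ` K \<subseteq> S"
    using p(1) by (auto simp: f_def)
  have "closure (f ` K) = S"
  proof (rule hilbert_subspace_eqI)
    show 1: "closure (f ` K) \<subseteq> S"
      using fS S'(2) by (rule closure_minimal)
    show "hilbert_space (closure (f ` K))"
      by (rule hilbert_space_closed_subset[OF S 1 csubspace_closure[OF sub]]) simp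
    fix x assume x: "x \<in> S" and orth: "\<And>s. s \<in> closure (f ` K) \<Longrightarrow> cinner x s = 0"
    \<comment> \<open>For \<open>x\<close> in \<open>S\<close>, the vector \<open>(fst x, 0)\<close>
      and its projection have the same inner product with \<open>x\<close>. Orthogonality to the
      range of \<open>f\<close> therefore makes the norm of \<open>fst x\<close> zero.\<close>
    have "f (fst x) \<in> closure (f ` K)"
      using x SK by (intro subsetD[OF closure_subset] imageI) auto
    then have "cinner (f (fst x)) x = 0"
      using orth cinner_eq_0_commute by metis
    then have "cinner (fst x, 0) x = 0"
      using p(2)[OF x, of "(fst x, 0)"] by (simp add: f_def cinner_diff_left)
    then have "fst x = 0"
      by (simp add: cinner_prod_def)
    then show "x = 0"
      using inj[of "snd x"] x by (metis prod.collapse zero_prod_def)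
  qed (rule S')
  then show ?thesis
    using separable_space_dense_image[OF K(2) cont fS] by simp
qed

section \<open>Density of the range of the boundary map and separability of the boundary
  space\<close>

lemma quasi_boundary_triple_dense_range:
  assumes "quasi_boundary_triple H A T G \<Gamma>\<^sub>0 \<Gamma>\<^sub>1"
  shows "G \<subseteq> closure (\<Gamma>\<^sub>0 ` T)"
proof
  fix x assume x: "x \<in> G"
  have "G \<times> G \<subseteq> closure ((\<lambda>f. (\<Gamma>\<^sub>0 f, \<Gamma>\<^sub>1 f)) ` T)"
    using assms by (simp add: quasi_boundary_triple_def)
  also have "\<dots> \<subseteq> closure (\<Gamma>\<^sub>0 ` T \<times> UNIV)"
    by (rule closure_mono) auto
  finally show "x \<in> closure (\<Gamma>\<^sub>0 ` T)"
    using x by (auto simp: closure_Times)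
qed

lemma quasi_boundary_triple_separable:
  assumes H: "separable_hilbert_space H" and Q: "quasi_boundary_triple H A T G \<Gamma>\<^sub>0 \<Gamma>\<^sub>1"
  shows "separable_hilbert_space G"
proof -
  have hH: "hilbert_space H" and sH: "separable_space (top_of_set H)"
    using H by (auto simp: separable_hilbert_space_def)
  have G: "hilbert_space G" and TA: "T \<subseteq> rel_adj H H A"
    and dense: "G \<times> G \<subseteq> closure ((\<lambda>f. (\<Gamma>\<^sub>0 f, \<Gamma>\<^sub>1 f)) ` T)"
    and lin: "linear_map_on T G \<Gamma>\<^sub>0" "linear_map_on T G \<Gamma>\<^sub>1"
    and green: "\<And>f g. f \<in> T \<Longrightarrow> g \<in> T \<Longrightarrow> cinner (snd f) (fst g) - cinner (fst f) (snd g) =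
      cinner (\<Gamma>\<^sub>1 f) (\<Gamma>\<^sub>0 g) - cinner (\<Gamma>\<^sub>0 f) (\<Gamma>\<^sub>1 g)"
    using Q by (auto simp: quasi_boundary_triple_def)
  have TH: "T \<subseteq> H \<times> H"
    using TA by (auto simp: rel_adj_def)
  have T: "csubspace T" and mem: "\<And>f. f \<in> T \<Longrightarrow> \<Gamma>\<^sub>0 f \<in> G" "\<And>f. f \<in> T \<Longrightarrow> \<Gamma>\<^sub>1 f \<in> G"
    and add: "\<And>f g. f \<in> T \<Longrightarrow> g \<in> T \<Longrightarrow> \<Gamma>\<^sub>0 (f + g) = \<Gamma>\<^sub>0 f + \<Gamma>\<^sub>0 g"
      "\<And>f g. f \<in> T \<Longrightarrow> g \<in> T \<Longrightarrow> \<Gamma>\<^sub>1 (f + g) = \<Gamma>\<^sub>1 f + \<Gamma>\<^sub>1 g"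
    and scale: "\<And>c f. f \<in> T \<Longrightarrow> \<Gamma>\<^sub>0 (c *\<^sub>C f) = c *\<^sub>C \<Gamma>\<^sub>0 f" "\<And>c f. f \<in> T \<Longrightarrow> \<Gamma>\<^sub>1 (c *\<^sub>C f) = c *\<^sub>C \<Gamma>\<^sub>1 f"
    using lin by (auto simp: linear_map_on_def)
  define gr where "gr f = (f, \<Gamma>\<^sub>0 f, \<Gamma>\<^sub>1 f)" for f
  define S where "S = closure (gr ` T)"
  have KL: "hilbert_space ((H \<times> H) \<times> (G \<times> G))"
    by (intro hilbert_space_Times hH G)
  have "csubspace (gr ` T)"
    unfolding complex_vector.subspace_def
  proof (intro conjI ballI allI)
    have "gr 0 = 0"
      using scale[OF complex_vector.subspace_0[OF T], of 0] by (simp add: gr_def zero_prod_def)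
    then show "0 \<in> gr ` T"
      using complex_vector.subspace_0[OF T] by (metis imageI)
    fix x c assume "x \<in> gr ` T"
    then obtain f where f: "f \<in> T" "x = gr f"
      by blast
    have "c *\<^sub>C x = gr (c *\<^sub>C f)"
      using f scale[OF f(1)] by (simp add: gr_def scaleC_prod_def)
    then show "c *\<^sub>C x \<in> gr ` T"
      using complex_vector.subspace_scale[OF T f(1)] by blast
    fix y assume "y \<in> gr ` T"
    then obtain g where g: "g \<in> T" "y = gr g"
      by blast
    have "x + y = gr (f + g)"
      using f g add[OF f(1) g(1)] by (simp add: gr_def)
    then show "x + y \<in> gr ` T"
      using complex_vector.subspace_add[OF T f(1) g(1)] by blast
  qed
  then have subS: "csubspace S"
    unfolding S_def by (rule csubspace_closure)
  have SKL: "S \<subseteq> (H \<times> H) \<times> (G \<times> G)"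
    unfolding S_def
  proof (rule closure_minimal)
    show "gr ` T \<subseteq> (H \<times> H) \<times> (G \<times> G)"
      using TH mem by (auto simp: gr_def)
    show "closed ((H \<times> H) \<times> (G \<times> G))"
      using KL by (simp add: hilbert_space_def complete_imp_closed)
  qed
  have S: "hilbert_space S"
    by (rule hilbert_space_closed_subset[OF KL SKL subS]) (simp add: S_def)
  have "separable_space (top_of_set S)"
  proof (rule separable_space_if_graph[OF S hilbert_space_Times[OF hH hH] separable_space_Times[OF sH sH]])
    show "fst ` S \<subseteq> H \<times> H"
      using SKL by auto
    fix y assume y: "(0, y) \<in> S"
    obtain y0 y1 where y01: "y = (y0, y1)"
      by fastforce
    have yG: "y0 \<in> G" "y1 \<in> G"
      using y SKL y01 by auto
    obtain s where s: "\<And>n. s n \<in> gr ` T" "s \<longlonglongrightarrow> (0, y0, y1)"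
      using y y01 by (auto simp: S_def closure_sequential)
    then have "\<forall>n. \<exists>f. f \<in> T \<and> s n = gr f"
      by blast
    from choice[OF this] obtain f where f: "\<And>n. f n \<in> T" "\<And>n. s n = gr (f n)"
      by blast
    have lims: "f \<longlonglongrightarrow> 0" "(\<lambda>n. \<Gamma>\<^sub>0 (f n)) \<longlonglongrightarrow> y0" "(\<lambda>n. \<Gamma>\<^sub>1 (f n)) \<longlonglongrightarrow> y1"
      using tendsto_fst[OF s(2)] tendsto_fst[OF tendsto_snd[OF s(2)]] tendsto_snd[OF tendsto_snd[OF s(2)]]
      by (auto simp: f gr_def)
    \<comment> \<open>In Green's identity for \<open>f n\<close> and \<open>g\<close> the left-hand
      side tends to zero because \<open>f n\<close> does, while the boundary values converge to
      \<open>y0\<close> and \<open>y1\<close>.\<close>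
    have eq: "cinner y1 (\<Gamma>\<^sub>0 g) - cinner y0 (\<Gamma>\<^sub>1 g) = 0" if g: "g \<in> T" for g
    proof -
      have "(\<lambda>n. cinner (snd (f n)) (fst g) - cinner (fst (f n)) (snd g)) \<longlonglongrightarrow>
          cinner (snd (0 :: 'a \<times> 'a)) (fst g) - cinner (fst (0 :: 'a \<times> 'a)) (snd g)"
        by (intro tendsto_diff tendsto_cinner tendsto_const tendsto_fst tendsto_snd lims)
      moreover have "(\<lambda>n. cinner (\<Gamma>\<^sub>1 (f n)) (\<Gamma>\<^sub>0 g) - cinner (\<Gamma>\<^sub>0 (f n)) (\<Gamma>\<^sub>1 g)) \<longlonglongrightarrow>
          cinner y1 (\<Gamma>\<^sub>0 g) - cinner y0 (\<Gamma>\<^sub>1 g)"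
        by (intro tendsto_diff tendsto_cinner tendsto_const lims)
      ultimately show ?thesis
        using LIMSEQ_unique by (fastforce simp: green[OF f(1) g])
    qed
    \<comment> \<open>The preceding equation says that the rotated limit \<open>(y1, - y0)\<close>
      is orthogonal to the range of the pair of boundary maps. As this range is dense in
      \<open>G \<times> G\<close>, the limit vanishes: the boundary map is closable.\<close>
    have "cinner (y1, - y0) (y1, - y0) = 0"
    proof (rule cinner_closure_eq_0)
      show "cinner (y1, - y0) z = 0" if z: "z \<in> (\<lambda>f. (\<Gamma>\<^sub>0 f, \<Gamma>\<^sub>1 f)) ` T" for z
        using z eq by (auto simp: cinner_prod_def cinner_minus_left)
      have "- y0 \<in> G"
        using yG G complex_vector.subspace_neg by (auto simp: hilbert_space_def)
      then show "(y1, - y0) \<in> closure ((\<lambda>f. (\<Gamma>\<^sub>0 f, \<Gamma>\<^sub>1 f)) ` T)"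
        using dense yG by blast
    qed
    then show "y = 0"
      using y01 by (simp add: zero_prod_def)
  qed
  moreover have "continuous_on S (\<lambda>x. fst (snd x))"
    by (intro continuous_intros)
  moreover have "(\<lambda>x. fst (snd x)) ` S \<subseteq> G"
    using SKL by auto
  \<comment> \<open>The image of \<open>S\<close> contains the range of
    \<open>\<Gamma>\<^sub>0\<close>, so it is dense in \<open>G\<close>; separability passes from
    \<open>S\<close> to \<open>G\<close> along this projection.\<close>
  moreover have "\<Gamma>\<^sub>0 ` T \<subseteq> (\<lambda>x. fst (snd x)) ` S"
  proof
    fix x assume "x \<in> \<Gamma>\<^sub>0 ` T"
    then obtain f where "f \<in> T" "x = \<Gamma>\<^sub>0 f"
      by blast
    then have "gr f \<in> S" "x = fst (snd (gr f))"
      unfolding S_def by (auto simp: gr_def intro!: subsetD[OF closure_subset])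
    then show "x \<in> (\<lambda>x. fst (snd x)) ` S"
      by blast
  qed
  then have "G \<subseteq> closure ((\<lambda>x. fst (snd x)) ` S)"
    by (rule order_trans[OF quasi_boundary_triple_dense_range[OF Q] closure_mono])
  ultimately show ?thesis
    unfolding separable_hilbert_space_def using separable_space_dense_image G by blast
qed

section \<open>Operators as functions\<close>

text \<open>Composites and differences of everywhere defined operators are computed with functions;
  \<open>graph_on\<close> carries the results back to relations.\<close>

definition graph_on :: "'a set \<Rightarrow> ('a \<Rightarrow> 'b) \<Rightarrow> ('a \<times> 'b) set"
  where "graph_on H f = (\<lambda>x. (x, f x)) ` H"

definition bounded_map_on :: "'a :: complex_inner set \<Rightarrow> 'a set \<Rightarrow> ('a \<Rightarrow> 'a) \<Rightarrow> bool"
  where "bounded_map_on H K f \<longleftrightarrow> linear_map_on H K f \<and> (\<exists>c. \<forall>x\<in>H. norm (f x) \<le> c * norm x)"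

lemma mem_graph_on [simp]: "(x, y) \<in> graph_on H f \<longleftrightarrow> x \<in> H \<and> y = f x"
  by (auto simp: graph_on_def)

lemma graph_on_cong: "(\<And>x. x \<in> H \<Longrightarrow> f x = g x) \<Longrightarrow> graph_on H f = graph_on H g"
  by (auto simp: graph_on_def)

lemma graph_on_comp: "f ` H \<subseteq> K \<Longrightarrow> graph_on H f O graph_on K g = graph_on H (\<lambda>x. g (f x))"
  by (auto simp: graph_on_def relcomp_unfold)

lemma rel_diff_graph_on: "rel_diff (graph_on H f) (graph_on H g) = graph_on H (\<lambda>x. f x - g x)"
  by (auto simp: rel_diff_def graph_on_def)

lemma linear_map_onD:
  assumes "linear_map_on T G F"
  shows "csubspace T" "x \<in> T \<Longrightarrow> F x \<in> G" "x \<in> T \<Longrightarrow> y \<in> T \<Longrightarrow> F (x + y) = F x + F y"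
    "x \<in> T \<Longrightarrow> F (c *\<^sub>C x) = c *\<^sub>C F x"
  using assms by (auto simp: linear_map_on_def)

lemma linear_map_on_diff:
  assumes F: "linear_map_on T G F" and xy: "x \<in> T" "y \<in> T"
  shows "F (x - y) = F x - F y"
proof -
  have "F (x - y + y) = F (x - y) + F y"
    using complex_vector.subspace_diff[OF linear_map_onD(1)[OF F] xy] xy(2)
    by (rule linear_map_onD(3)[OF F])
  then show ?thesis
    by (simp add: eq_diff_eq)
qed

lemma linear_relation_graph_on:
  assumes F: "linear_map_on H K f"
  shows "linear_relation H K (graph_on H f)"
  unfolding linear_relation_def complex_vector.subspace_def
proof (intro conjI ballI allI)
  note H = linear_map_onD(1)[OF F]
  show "graph_on H f \<subseteq> H \<times> K"
    using linear_map_onD(2)[OF F] by (auto simp: graph_on_def)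
  show "0 \<in> graph_on H f"
    using linear_map_onD(4)[OF F, of 0 0] complex_vector.subspace_0[OF H] by (simp add: zero_prod_def)
  fix x c assume x: "x \<in> graph_on H f"
  then show "c *\<^sub>C x \<in> graph_on H f"
    using linear_map_onD(4)[OF F] complex_vector.subspace_scale[OF H]
    by (cases x) (simp add: scaleC_prod_def)
  fix y assume "y \<in> graph_on H f"
  with x show "x + y \<in> graph_on H f"
    using linear_map_onD(3)[OF F] complex_vector.subspace_add[OF H]
    by (cases x, cases y) simp
qed

lemma graph_on_bounded_ops:
  assumes "bounded_map_on H K f"
  shows "graph_on H f \<in> bounded_ops H K"
proof -
  obtain c where "\<forall>x\<in>H. norm (f x) \<le> c * norm x"
    using assms by (auto simp: bounded_map_on_def)
  then have "\<exists>c. \<forall>(x, y)\<in>graph_on H f. norm y \<le> c * norm x"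
    by (intro exI[of _ c]) auto
  then show ?thesis
    using assms linear_relation_graph_on[of H K f] by (simp add: bounded_ops_def bounded_map_on_def)
qed

lemma bounded_ops_graph_on:
  assumes H: "csubspace H" and B: "B \<in> bounded_ops H K"
  obtains f where "B = graph_on H f" "bounded_map_on H K f"
proof -
  have sub: "csubspace B" and BHK: "B \<subseteq> H \<times> K" and ex: "\<And>x. x \<in> H \<Longrightarrow> \<exists>!y. (x, y) \<in> B"
    using B by (auto simp: bounded_ops_def linear_relation_def)
  define f where "f x = (THE y. (x, y) \<in> B)" for x
  have f: "(x, f x) \<in> B" if "x \<in> H" for x
    unfolding f_def using ex[OF that] by (rule theI')
  have unique: "y = f x" if "(x, y) \<in> B" for x y
    using that BHK ex f by blast
  have "B = graph_on H f"
    using f unique BHK by (auto simp: graph_on_def)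
  moreover have "linear_map_on H K f"
    unfolding linear_map_on_def
  proof (intro conjI ballI allI H)
    show "f ` H \<subseteq> K"
      using f BHK by auto
    fix x c assume x: "x \<in> H"
    show "f (c *\<^sub>C x) = c *\<^sub>C f x"
      using unique complex_vector.subspace_scale[OF sub f[OF x], of c] by (simp add: scaleC_prod_def)
    fix y assume y: "y \<in> H"
    show "f (x + y) = f x + f y"
      using unique[of "x + y" "f x + f y"] complex_vector.subspace_add[OF sub f[OF x] f[OF y]] by simp
  qed
  moreover have "\<exists>c. \<forall>x\<in>H. norm (f x) \<le> c * norm x"
  proof -
    obtain c where "\<forall>(x, y)\<in>B. norm y \<le> c * norm x"
      using B by (auto simp: bounded_ops_def)
    then show ?thesis
      using f by (intro exI[of _ c]) auto
  qed
  ultimately show ?thesis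
    using that by (simp add: bounded_map_on_def)
qed

lemma tendsto_bounded_map_on:
  assumes f: "bounded_map_on H K f" and s: "\<And>n. s n \<in> H" "s \<longlonglongrightarrow> x" "x \<in> H"
  shows "(\<lambda>n. f (s n)) \<longlonglongrightarrow> f x"
proof -
  have lin: "linear_map_on H K f"
    using f by (simp add: bounded_map_on_def)
  obtain c where c: "\<And>x. x \<in> H \<Longrightarrow> norm (f x) \<le> c * norm x"
    using f by (auto simp: bounded_map_on_def)
  have le: "norm (f (s n) - f x) \<le> c * norm (s n - x)" for n
    using c[OF complex_vector.subspace_diff[OF linear_map_onD(1)[OF lin] s(1) s(3)]]
    by (simp add: linear_map_on_diff[OF lin s(1) s(3)])
  have "(\<lambda>n. c * norm (s n - x)) \<longlonglongrightarrow> c * norm (x - x)"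
    by (intro tendsto_intros s)
  then have lim0: "(\<lambda>n. c * norm (s n - x)) \<longlonglongrightarrow> 0"
    by simp
  have "(\<lambda>n. f (s n) - f x) \<longlonglongrightarrow> 0"
    by (rule Lim_null_comparison[OF always_eventually[OF allI[OF le]] lim0])
  then show ?thesis
    by (simp add: LIM_zero_iff)
qed

text \<open>The closed graph theorem for functions: it suffices to identify the limit of the values
  when both arguments and values converge. Both boundary operators in the main construction are
  bounded in this way.\<close>

lemma bounded_map_on_if_closed:
  assumes H: "hilbert_space H" and G: "hilbert_space G" and f: "linear_map_on H G f"
    and closed: "\<And>s x y. (\<And>n. s n \<in> H) \<Longrightarrow> s \<longlonglongrightarrow> x \<Longrightarrow> (\<lambda>n. f (s n)) \<longlonglongrightarrow> y \<Longrightarrow> x \<in> H \<Longrightarrow> y \<in> G \<Longrightarrow>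
      y = f x"
  shows "bounded_map_on H G f"
proof -
  have "graph_on H f \<in> bounded_ops H G"
  proof (rule closed_graph_theorem[OF H G linear_relation_graph_on[OF f]])
    fix s t x y
    assume st: "\<And>n. (s n, t n) \<in> graph_on H f" and "s \<longlonglongrightarrow> x" "t \<longlonglongrightarrow> y" and xy: "x \<in> H" "y \<in> G"
    moreover have "t = (\<lambda>n. f (s n))"
      using st by auto
    ultimately have "y = f x"
      using closed[of s x y] by auto
    then show "(x, y) \<in> graph_on H f"
      using xy by simp
  qed simp
  then show ?thesis
    using f by (auto simp: bounded_ops_def bounded_map_on_def graph_on_def)
qed

text \<open>This provides the bounded factors \<open>I + c R\<close>, with \<open>R\<close> a
  resolvent, by which resolvent identities change the spectral parameter.\<close>

lemma bounded_map_on_shift: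
  assumes f: "bounded_map_on H H f"
  shows "bounded_map_on H H (\<lambda>h. h + c *\<^sub>C f h)"
proof -
  have lin: "linear_map_on H H f"
    using f by (simp add: bounded_map_on_def)
  note F = linear_map_onD[OF lin]
  obtain d where d: "\<And>x. x \<in> H \<Longrightarrow> norm (f x) \<le> d * norm x"
    using f by (auto simp: bounded_map_on_def)
  have "norm (h + c *\<^sub>C f h) \<le> (1 + norm c * d) * norm h" if "h \<in> H" for h
  proof -
    have "norm (h + c *\<^sub>C f h) \<le> norm h + norm c * norm (f h)"
      by (metis norm_triangle_ineq norm_scaleC)
    also have "\<dots> \<le> norm h + norm c * (d * norm h)"
      by (intro add_left_mono mult_left_mono d that) simp
    finally show ?thesis
      by (simp add: algebra_simps)
  qed
  moreover have "linear_map_on H H (\<lambda>h. h + c *\<^sub>C f h)"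
    unfolding linear_map_on_def
  proof (intro conjI ballI allI F(1))
    show "(\<lambda>h. h + c *\<^sub>C f h) ` H \<subseteq> H"
      using F(2) by (auto intro: complex_vector.subspace_add complex_vector.subspace_scale F(1))
    fix x a assume x: "x \<in> H"
    show "a *\<^sub>C x + c *\<^sub>C f (a *\<^sub>C x) = a *\<^sub>C (x + c *\<^sub>C f x)"
      using x by (simp add: F(4) scaleC_add_right scaleC_scaleC mult.commute)
    fix y assume "y \<in> H"
    with x show "x + y + c *\<^sub>C f (x + y) = x + c *\<^sub>C f x + (y + c *\<^sub>C f y)"
      by (simp add: F(3) scaleC_add_right algebra_simps)
  qed
  ultimately show ?thesis
    unfolding bounded_map_on_def by blast
qed

section \<open>Resolvents\<close>

text \<open>The last two properties say that \<open>r\<close> inverts \<open>S - \<mu>\<close> from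
  both sides. They are phrased by membership in \<open>S\<close>, since \<open>S\<close> may be
  multivalued.\<close>

lemma resolvent_map:
  assumes H: "csubspace H" and S: "linear_relation H H S" and \<mu>: "\<mu> \<in> resolvent_set H S"
  obtains r where "(rel_shift S \<mu>)\<inverse> = graph_on H r" "bounded_map_on H H r"
    "\<And>h. h \<in> H \<Longrightarrow> (r h, h + \<mu> *\<^sub>C r h) \<in> S" "\<And>f f'. (f, f') \<in> S \<Longrightarrow> r (f' - \<mu> *\<^sub>C f) = f"
proof -
  obtain r where r: "(rel_shift S \<mu>)\<inverse> = graph_on H r" "bounded_map_on H H r"
    using bounded_ops_graph_on[OF H] \<mu> unfolding resolvent_set_def by blast
  have 1: "(f, h + \<mu> *\<^sub>C f) \<in> S \<longleftrightarrow> h \<in> H \<and> f = r h" for h f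
    unfolding mem_resolvent[symmetric] r by simp
  show ?thesis
  proof (rule that[OF r])
    show "(r h, h + \<mu> *\<^sub>C r h) \<in> S" if "h \<in> H" for h
      using 1 that by blast
    show "r (f' - \<mu> *\<^sub>C f) = f" if "(f, f') \<in> S" for f f'
      using 1[of f "f' - \<mu> *\<^sub>C f"] that by simp
  qed
qed

text \<open>For the first identity, \<open>r h\<close> is the first component of an element of
  \<open>S\<close>, and subtracting \<open>\<nu>\<close> instead of \<open>\<mu>\<close> times it
  changes the image by \<open>(\<mu> - \<nu>) r h\<close>. For the second, a combination of two
  elements of \<open>S\<close> has the left-hand side as first component and is mapped to
  \<open>h\<close> by \<open>S - \<mu>\<close>.\<close>

lemma resolvent_identity:
  assumes S: "csubspace S" and r: "\<And>h. h \<in> H \<Longrightarrow> (r h, h + \<mu> *\<^sub>C r h) \<in> S"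
    "\<And>f f'. (f, f') \<in> S \<Longrightarrow> r (f' - \<mu> *\<^sub>C f) = f" "\<And>h. h \<in> H \<Longrightarrow> r h \<in> H"
    and q: "\<And>h. h \<in> H \<Longrightarrow> (q h, h + \<nu> *\<^sub>C q h) \<in> S"
    "\<And>f f'. (f, f') \<in> S \<Longrightarrow> q (f' - \<nu> *\<^sub>C f) = f" "\<And>h. h \<in> H \<Longrightarrow> q h \<in> H"
    and h: "h \<in> H"
  shows "q (h + (\<mu> - \<nu>) *\<^sub>C r h) = r h" "q h + (\<mu> - \<nu>) *\<^sub>C r (q h) = r h"
proof -
  have "h + (\<mu> - \<nu>) *\<^sub>C r h = h + \<mu> *\<^sub>C r h - \<nu> *\<^sub>C r h"
    by (simp add: complex_vector.scale_left_diff_distrib)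
  then show "q (h + (\<mu> - \<nu>) *\<^sub>C r h) = r h"
    using q(2)[OF r(1)[OF h]] by (simp only:)
  let ?g = "r (q h)"
  have "(q h, h + \<nu> *\<^sub>C q h) + (\<mu> - \<nu>) *\<^sub>C (?g, q h + \<mu> *\<^sub>C ?g) \<in> S"
    by (rule complex_vector.subspace_add[OF S q(1)[OF h]
          complex_vector.subspace_scale[OF S r(1)[OF q(3)[OF h]]]])
  then have "(q h + (\<mu> - \<nu>) *\<^sub>C ?g, h + \<nu> *\<^sub>C q h + (\<mu> - \<nu>) *\<^sub>C (q h + \<mu> *\<^sub>C ?g)) \<in> S"
    by (simp add: scaleC_prod_def)
  from r(2)[OF this]
  have "r (h + \<nu> *\<^sub>C q h + (\<mu> - \<nu>) *\<^sub>C (q h + \<mu> *\<^sub>C ?g) - \<mu> *\<^sub>C (q h + (\<mu> - \<nu>) *\<^sub>C ?g))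
      = q h + (\<mu> - \<nu>) *\<^sub>C ?g" .
  moreover have "h + \<nu> *\<^sub>C q h + (\<mu> - \<nu>) *\<^sub>C (q h + \<mu> *\<^sub>C ?g) - \<mu> *\<^sub>C (q h + (\<mu> - \<nu>) *\<^sub>C ?g) = h"
    by (simp add: scaleC_add_right scaleC_scaleC complex_vector.scale_left_diff_distrib algebra_simps)
  ultimately show "q h + (\<mu> - \<nu>) *\<^sub>C ?g = r h"
    by simp
qed

lemma operator_ideal_comp:
  assumes "operator_ideal_class \<AA>" "separable_hilbert_space H" "separable_hilbert_space K"
    "separable_hilbert_space H\<^sub>1" "separable_hilbert_space K\<^sub>1"
    "A \<in> \<AA> H K" "B \<in> bounded_ops H\<^sub>1 H" "C \<in> bounded_ops K K\<^sub>1"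
  shows "B O A O C \<in> \<AA> H\<^sub>1 K\<^sub>1"
  by (rule assms(1)[unfolded operator_ideal_class_def, THEN conjunct2, rule_format, OF _ assms(6-8)])
    (intro conjI assms)

text \<open>With \<open>D(\<mu>)\<close> the resolvent difference,
  \<open>D(\<mu>) = (I + (\<mu> - \<nu>) (S\<^sub>1 - \<mu>)\<^sup>-\<^sup>1) D(\<nu>) (I + (\<mu> - \<nu>) (S\<^sub>2 - \<mu>)\<^sup>-\<^sup>1)\<close>.\<close>

lemma resolvent_difference_in_ideal:
  assumes I: "operator_ideal_class \<AA>" and H: "separable_hilbert_space H"
    and S: "linear_relation H H S\<^sub>1" "linear_relation H H S\<^sub>2"
    and \<mu>: "\<mu> \<in> resolvent_set H S\<^sub>1" "\<mu> \<in> resolvent_set H S\<^sub>2"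
    and \<nu>: "\<nu> \<in> resolvent_set H S\<^sub>1" "\<nu> \<in> resolvent_set H S\<^sub>2"
    and D: "rel_diff ((rel_shift S\<^sub>1 \<nu>)\<inverse>) ((rel_shift S\<^sub>2 \<nu>)\<inverse>) \<in> \<AA> H H"
  shows "rel_diff ((rel_shift S\<^sub>1 \<mu>)\<inverse>) ((rel_shift S\<^sub>2 \<mu>)\<inverse>) \<in> \<AA> H H"
proof -
  have H': "csubspace H"
    using H by (simp add: separable_hilbert_space_def hilbert_space_def)
  have S': "csubspace S\<^sub>1" "csubspace S\<^sub>2"
    using S by (auto simp: linear_relation_def)
  obtain r1 where r1: "(rel_shift S\<^sub>1 \<mu>)\<inverse> = graph_on H r1" "bounded_map_on H H r1"
    "\<And>h. h \<in> H \<Longrightarrow> (r1 h, h + \<mu> *\<^sub>C r1 h) \<in> S\<^sub>1" "\<And>f f'. (f, f') \<in> S\<^sub>1 \<Longrightarrow> r1 (f' - \<mu> *\<^sub>C f) = f"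
    using resolvent_map[OF H' S(1) \<mu>(1)] by metis
  obtain r2 where r2: "(rel_shift S\<^sub>2 \<mu>)\<inverse> = graph_on H r2" "bounded_map_on H H r2"
    "\<And>h. h \<in> H \<Longrightarrow> (r2 h, h + \<mu> *\<^sub>C r2 h) \<in> S\<^sub>2" "\<And>f f'. (f, f') \<in> S\<^sub>2 \<Longrightarrow> r2 (f' - \<mu> *\<^sub>C f) = f"
    using resolvent_map[OF H' S(2) \<mu>(2)] by metis
  obtain q1 where q1: "(rel_shift S\<^sub>1 \<nu>)\<inverse> = graph_on H q1" "bounded_map_on H H q1"
    "\<And>h. h \<in> H \<Longrightarrow> (q1 h, h + \<nu> *\<^sub>C q1 h) \<in> S\<^sub>1" "\<And>f f'. (f, f') \<in> S\<^sub>1 \<Longrightarrow> q1 (f' - \<nu> *\<^sub>C f) = f"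
    using resolvent_map[OF H' S(1) \<nu>(1)] by metis
  obtain q2 where q2: "(rel_shift S\<^sub>2 \<nu>)\<inverse> = graph_on H q2" "bounded_map_on H H q2"
    "\<And>h. h \<in> H \<Longrightarrow> (q2 h, h + \<nu> *\<^sub>C q2 h) \<in> S\<^sub>2" "\<And>f f'. (f, f') \<in> S\<^sub>2 \<Longrightarrow> q2 (f' - \<nu> *\<^sub>C f) = f"
    using resolvent_map[OF H' S(2) \<nu>(2)] by metis
  have lin: "linear_map_on H H r1" "linear_map_on H H r2" "linear_map_on H H q1" "linear_map_on H H q2"
    using r1(2) r2(2) q1(2) q2(2) by (simp_all add: bounded_map_on_def)
  note mem = lin[THEN linear_map_onD(2)]
  define u where "u h = h + (\<mu> - \<nu>) *\<^sub>C r2 h" for h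
  define v where "v h = h + (\<mu> - \<nu>) *\<^sub>C r1 h" for h
  have bd: "bounded_map_on H H u" "bounded_map_on H H v"
    unfolding u_def v_def by (intro bounded_map_on_shift r1(2) r2(2))+
  then have linuv: "linear_map_on H H u" "linear_map_on H H v"
    by (simp_all add: bounded_map_on_def)
  note memuv = linuv[THEN linear_map_onD(2)]
  \<comment> \<open>The right factor turns \<open>q2\<close> into \<open>r2\<close>, and the left
    factor turns \<open>q1\<close> into \<open>r1\<close>. The remaining mixed terms
    \<open>(\<mu> - \<nu>) r1 (r2 h)\<close> cancel.\<close>
  have key: "v (q1 (u h) - q2 (u h)) = r1 h - r2 h" if h: "h \<in> H" for h
  proof -
    have "q2 (u h) = r2 h"
      unfolding u_def by (rule resolvent_identity(1)[OF S'(2) r2(3,4) mem(2) q2(3,4) mem(4) h])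
    moreover have "v (q1 (u h)) = r1 (u h)"
      unfolding v_def
      by (rule resolvent_identity(2)[OF S'(1) r1(3,4) mem(1) q1(3,4) mem(3) memuv(1)[OF h]])
    moreover have "r1 (u h) = r1 h + (\<mu> - \<nu>) *\<^sub>C r1 (r2 h)"
      using h mem complex_vector.subspace_scale[OF H']
      by (simp add: u_def linear_map_onD(3,4)[OF lin(1)])
    ultimately show ?thesis
      using h mem memuv by (simp add: linear_map_on_diff[OF linuv(2)]) (simp add: v_def)
  qed
  have "graph_on H u O graph_on H (\<lambda>h. q1 h - q2 h) O graph_on H v \<in> \<AA> H H"
    using D unfolding q1(1) q2(1) rel_diff_graph_on
    by (intro operator_ideal_comp[OF I H H H H] graph_on_bounded_ops bd)
  also have "graph_on H u O graph_on H (\<lambda>h. q1 h - q2 h) O graph_on H v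
      = graph_on H (\<lambda>h. v (q1 (u h) - q2 (u h)))"
    using mem memuv complex_vector.subspace_diff[OF H'] by (simp add: graph_on_comp image_subset_iff)
  also have "\<dots> = rel_diff ((rel_shift S\<^sub>1 \<mu>)\<inverse>) ((rel_shift S\<^sub>2 \<mu>)\<inverse>)"
    unfolding r1(1) r2(1) rel_diff_graph_on by (rule graph_on_cong[OF key])
  finally show ?thesis .
qed

section \<open>Quasi boundary triples\<close>

text \<open>Boundary maps act on pairs, so a resolvent is first lifted to pairs in \<open>T\<close>.
  The lift is linear in \<open>h\<close>, and composing it with a boundary map gives an operator
  from \<open>H\<close> to \<open>G\<close>.\<close>

lemma linear_map_on_pair_resolvent:
  assumes F: "linear_map_on T G F" and r: "linear_map_on H H r"
    and rT: "\<And>h. h \<in> H \<Longrightarrow> (r h, h + \<mu> *\<^sub>C r h) \<in> T"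
  shows "linear_map_on H G (\<lambda>h. F (r h, h + \<mu> *\<^sub>C r h))"
  unfolding linear_map_on_def
proof (intro conjI ballI allI)
  note R = linear_map_onD[OF r]
  show "csubspace H"
    by (rule R)
  show "(\<lambda>h. F (r h, h + \<mu> *\<^sub>C r h)) ` H \<subseteq> G"
    using linear_map_onD(2)[OF F rT] by auto
  fix x c assume x: "x \<in> H"
  have "(r (c *\<^sub>C x), c *\<^sub>C x + \<mu> *\<^sub>C r (c *\<^sub>C x)) = c *\<^sub>C (r x, x + \<mu> *\<^sub>C r x)"
    using x by (simp add: R(4) scaleC_prod_def scaleC_add_right scaleC_scaleC mult.commute)
  then show "F (r (c *\<^sub>C x), c *\<^sub>C x + \<mu> *\<^sub>C r (c *\<^sub>C x)) = c *\<^sub>C F (r x, x + \<mu> *\<^sub>C r x)"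
    using linear_map_onD(4)[OF F rT[OF x]] by (simp only:)
  fix y assume y: "y \<in> H"
  have "(r (x + y), x + y + \<mu> *\<^sub>C r (x + y)) = (r x, x + \<mu> *\<^sub>C r x) + (r y, y + \<mu> *\<^sub>C r y)"
    using x y by (simp add: R(3) scaleC_add_right algebra_simps)
  then show "F (r (x + y), x + y + \<mu> *\<^sub>C r (x + y)) = F (r x, x + \<mu> *\<^sub>C r x) + F (r y, y + \<mu> *\<^sub>C r y)"
    using linear_map_onD(3)[OF F rT[OF x] rT[OF y]] by (simp only:)
qed

lemma linear_relation_restriction_by:
  assumes "linear_map_on T G \<Gamma>\<^sub>0" "linear_map_on T G \<Gamma>\<^sub>1" "T \<subseteq> H \<times> H" "csubspace \<Theta>"
  shows "linear_relation H H (restriction_by T \<Gamma>\<^sub>0 \<Gamma>\<^sub>1 \<Theta>)"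
  unfolding linear_relation_def complex_vector.subspace_def
proof (intro conjI ballI allI)
  note T = linear_map_onD(1)[OF assms(1)]
  note \<Gamma> = linear_map_onD(3,4)[OF assms(1)] linear_map_onD(3,4)[OF assms(2)]
  show "restriction_by T \<Gamma>\<^sub>0 \<Gamma>\<^sub>1 \<Theta> \<subseteq> H \<times> H"
    using assms(3) by (auto simp: restriction_by_def)
  have 0: "0 \<in> T"
    by (rule complex_vector.subspace_0[OF T])
  have "\<Gamma>\<^sub>0 0 = 0" "\<Gamma>\<^sub>1 0 = 0"
    using \<Gamma>(2,4)[OF 0, of 0] by simp_all
  then show "0 \<in> restriction_by T \<Gamma>\<^sub>0 \<Gamma>\<^sub>1 \<Theta>"
    using 0 complex_vector.subspace_0[OF assms(4)] by (simp add: restriction_by_def zero_prod_def)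
  fix x c assume x: "x \<in> restriction_by T \<Gamma>\<^sub>0 \<Gamma>\<^sub>1 \<Theta>"
  then have x': "x \<in> T" "(\<Gamma>\<^sub>0 x, \<Gamma>\<^sub>1 x) \<in> \<Theta>"
    by (auto simp: restriction_by_def)
  show "c *\<^sub>C x \<in> restriction_by T \<Gamma>\<^sub>0 \<Gamma>\<^sub>1 \<Theta>"
  proof -
    have "(c *\<^sub>C \<Gamma>\<^sub>0 x, c *\<^sub>C \<Gamma>\<^sub>1 x) \<in> \<Theta>"
      using complex_vector.subspace_scale[OF assms(4) x'(2), of c] by (simp add: scaleC_prod_def)
    then show ?thesis
      using x' complex_vector.subspace_scale[OF T] by (simp add: restriction_by_def \<Gamma>)
  qed
  fix y assume "y \<in> restriction_by T \<Gamma>\<^sub>0 \<Gamma>\<^sub>1 \<Theta>"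
  then have y': "y \<in> T" "(\<Gamma>\<^sub>0 y, \<Gamma>\<^sub>1 y) \<in> \<Theta>"
    by (auto simp: restriction_by_def)
  show "x + y \<in> restriction_by T \<Gamma>\<^sub>0 \<Gamma>\<^sub>1 \<Theta>"
    using x' y' complex_vector.subspace_add[OF assms(4) x'(2) y'(2)] complex_vector.subspace_add[OF T]
    by (simp add: restriction_by_def \<Gamma>)
qed

text \<open>The injectivity hypothesis enters at \<open>\<nu>\<close> and the ideal hypothesis at
  \<open>\<mu>\<close>. The points may differ: the \<open>\<gamma>\<close>-fields at them are
  related by a bounded factor built from the resolvent of \<open>A0\<close>.\<close>

lemma resolvent_difference_at_point:
  fixes H G :: "'a :: complex_inner set"
  assumes H: "separable_hilbert_space H"
    and Q: "quasi_boundary_triple H A T G \<Gamma>\<^sub>0 \<Gamma>\<^sub>1"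
    and I: "operator_ideal_class \<AA>"
    and \<nu>: "\<nu> \<in> resolvent_set H (restriction_by T \<Gamma>\<^sub>0 \<Gamma>\<^sub>1 \<Theta>)" "\<nu> \<in> resolvent_set H (map_ker T \<Gamma>\<^sub>0)"
    and \<Theta>: "csubspace \<Theta>"
    and inj: "rel_ker (closure (rel_diff \<Theta> (weyl_function T \<Gamma>\<^sub>0 \<Gamma>\<^sub>1 \<nu>))) = {0}"
    and \<mu>: "\<mu> \<in> resolvent_set H (map_ker T \<Gamma>\<^sub>0)"
    and \<gamma>: "rel_adj G H (gamma_field T \<Gamma>\<^sub>0 \<mu>) \<in> dual_ideal_class \<AA> H G"
  shows "rel_diff ((rel_shift (restriction_by T \<Gamma>\<^sub>0 \<Gamma>\<^sub>1 \<Theta>) \<nu>)\<inverse>) ((rel_shift (map_ker T \<Gamma>\<^sub>0) \<nu>)\<inverse>) \<in> \<AA> H H"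
proof -
  have sepG: "separable_hilbert_space G"
    by (rule quasi_boundary_triple_separable[OF H Q])
  have hH: "hilbert_space H" and H': "csubspace H" and hG: "hilbert_space G" and G': "csubspace G"
    using H sepG by (auto simp: separable_hilbert_space_def hilbert_space_def)
  have TA: "T \<subseteq> rel_adj H H A" and lin0: "linear_map_on T G \<Gamma>\<^sub>0" and lin1: "linear_map_on T G \<Gamma>\<^sub>1"
    and sa0: "self_adjoint_relation H (map_ker T \<Gamma>\<^sub>0)"
    and green: "\<And>f g. f \<in> T \<Longrightarrow> g \<in> T \<Longrightarrow> cinner (snd f) (fst g) - cinner (fst f) (snd g) =
      cinner (\<Gamma>\<^sub>1 f) (\<Gamma>\<^sub>0 g) - cinner (\<Gamma>\<^sub>0 f) (\<Gamma>\<^sub>1 g)"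
    using Q by (auto simp: quasi_boundary_triple_def)
  have TH: "T \<subseteq> H \<times> H"
    using TA by (auto simp: rel_adj_def)
  note T = linear_map_onD(1)[OF lin0]
  define A0 where "A0 = map_ker T \<Gamma>\<^sub>0"
  define A\<Theta> where "A\<Theta> = restriction_by T \<Gamma>\<^sub>0 \<Gamma>\<^sub>1 \<Theta>"
  have linA0: "linear_relation H H A0"
    using sa0 by (simp add: self_adjoint_relation_def A0_def)
  then have subA0: "csubspace A0"
    by (simp add: linear_relation_def)
  have linA\<Theta>: "linear_relation H H A\<Theta>"
    unfolding A\<Theta>_def by (rule linear_relation_restriction_by[OF lin0 lin1 TH \<Theta>])
  have A0: "f \<in> A0 \<longleftrightarrow> f \<in> T \<and> \<Gamma>\<^sub>0 f = 0" for f
    by (simp add: A0_def map_ker_def)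
  have A\<Theta>: "f \<in> A\<Theta> \<longleftrightarrow> f \<in> T \<and> (\<Gamma>\<^sub>0 f, \<Gamma>\<^sub>1 f) \<in> \<Theta>" for f
    by (simp add: A\<Theta>_def restriction_by_def)
  obtain q where q: "(rel_shift A0 \<nu>)\<inverse> = graph_on H q" "bounded_map_on H H q"
    "\<And>h. h \<in> H \<Longrightarrow> (q h, h + \<nu> *\<^sub>C q h) \<in> A0" "\<And>f f'. (f, f') \<in> A0 \<Longrightarrow> q (f' - \<nu> *\<^sub>C f) = f"
    using resolvent_map[OF H' linA0 \<nu>(2)[folded A0_def]] by metis
  obtain p where p: "(rel_shift A0 \<mu>)\<inverse> = graph_on H p" "bounded_map_on H H p"
    "\<And>h. h \<in> H \<Longrightarrow> (p h, h + \<mu> *\<^sub>C p h) \<in> A0" "\<And>f f'. (f, f') \<in> A0 \<Longrightarrow> p (f' - \<mu> *\<^sub>C f) = f"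
    using resolvent_map[OF H' linA0 \<mu>[folded A0_def]] by metis
  obtain t where t: "(rel_shift A\<Theta> \<nu>)\<inverse> = graph_on H t" "bounded_map_on H H t"
    "\<And>h. h \<in> H \<Longrightarrow> (t h, h + \<nu> *\<^sub>C t h) \<in> A\<Theta>" "\<And>f f'. (f, f') \<in> A\<Theta> \<Longrightarrow> t (f' - \<nu> *\<^sub>C f) = f"
    using resolvent_map[OF H' linA\<Theta> \<nu>(1)[folded A\<Theta>_def]] by metis
  have lin: "linear_map_on H H q" "linear_map_on H H p" "linear_map_on H H t"
    using q(2) p(2) t(2) by (simp_all add: bounded_map_on_def)
  note mem = lin[THEN linear_map_onD(2)]
  \<comment> \<open>The lifts of the two resolvents to elements of \<open>A0\<close> and
    \<open>A\<Theta>\<close>, on which the boundary maps can be evaluated.\<close>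
  define F where "F h = (q h, h + \<nu> *\<^sub>C q h)" for h
  define E where "E h = (t h, h + \<nu> *\<^sub>C t h)" for h
  have FT: "F h \<in> T" "\<Gamma>\<^sub>0 (F h) = 0" and ET: "E h \<in> T" "(\<Gamma>\<^sub>0 (E h), \<Gamma>\<^sub>1 (E h)) \<in> \<Theta>" if "h \<in> H" for h
    using q(3)[OF that] t(3)[OF that] by (simp_all add: A0 A\<Theta> F_def E_def)
  \<comment> \<open>This is the adjoint of the \<open>\<gamma>\<close>-field at
    \<open>cnj \<nu>\<close>. Its boundedness is derived here directly from Green's
    identity.\<close>
  define c where "c h = \<Gamma>\<^sub>1 (F h)" for h
  define b where "b h = \<Gamma>\<^sub>0 (E h)" for h
  have linc: "linear_map_on H G c"
    unfolding c_def F_def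
    by (rule linear_map_on_pair_resolvent[OF lin1 lin(1)]) (use FT(1) in \<open>simp add: F_def\<close>)
  have linb: "linear_map_on H G b"
    unfolding b_def E_def
    by (rule linear_map_on_pair_resolvent[OF lin0 lin(3)]) (use ET(1) in \<open>simp add: E_def\<close>)
  note memc = linear_map_onD(2)[OF linc] and memb = linear_map_onD(2)[OF linb]
  have bc: "bounded_map_on H G c"
  proof (rule bounded_map_on_if_closed[OF hH hG linc])
    fix s x y
    assume s: "\<And>n. s n \<in> H" "s \<longlonglongrightarrow> x" "(\<lambda>n. c (s n)) \<longlonglongrightarrow> y" and x: "x \<in> H" and y: "y \<in> G"
    have lim: "(\<lambda>n. F (s n)) \<longlonglongrightarrow> F x"
      unfolding F_def
      by (intro tendsto_Pair tendsto_add tendsto_scaleC s tendsto_bounded_map_on[OF q(2)] x)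
    \<comment> \<open>Since the first boundary value of \<open>F h\<close> is zero, Green's identity
      expresses the pairing of \<open>c h\<close> with \<open>\<Gamma>\<^sub>0 k\<close> through
      \<open>F h\<close> and \<open>k\<close>. As \<open>F\<close> is continuous, the pairings pass
      to the limit.\<close>
    have orth: "cinner (y - c x) (\<Gamma>\<^sub>0 k) = 0" if k: "k \<in> T" for k
    proof -
      have eq: "cinner (snd (F h)) (fst k) - cinner (fst (F h)) (snd k) = cinner (c h) (\<Gamma>\<^sub>0 k)"
        if "h \<in> H" for h
        using green[OF FT(1)[OF that] k] FT(2)[OF that] by (simp add: c_def)
      have "(\<lambda>n. cinner (snd (F (s n))) (fst k) - cinner (fst (F (s n))) (snd k)) \<longlonglongrightarrow>
          cinner (snd (F x)) (fst k) - cinner (fst (F x)) (snd k)"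
        by (intro tendsto_diff tendsto_cinner tendsto_const tendsto_fst tendsto_snd lim)
      then have "(\<lambda>n. cinner (c (s n)) (\<Gamma>\<^sub>0 k)) \<longlonglongrightarrow> cinner (c x) (\<Gamma>\<^sub>0 k)"
        by (simp only: eq[OF s(1)] eq[OF x])
      moreover have "(\<lambda>n. cinner (c (s n)) (\<Gamma>\<^sub>0 k)) \<longlonglongrightarrow> cinner y (\<Gamma>\<^sub>0 k)"
        by (intro tendsto_cinner tendsto_const s)
      ultimately have "cinner (c x) (\<Gamma>\<^sub>0 k) = cinner y (\<Gamma>\<^sub>0 k)"
        by (rule LIMSEQ_unique)
      then show ?thesis
        by (simp add: cinner_diff_left)
    qed
    have "y - c x \<in> closure (\<Gamma>\<^sub>0 ` T)"
      using quasi_boundary_triple_dense_range[OF Q] complex_vector.subspace_diff[OF G' y memc[OF x]] ..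
    then have "cinner (y - c x) (y - c x) = 0"
      by (rule cinner_closure_eq_0[rotated]) (use orth in blast)
    then show "y = c x"
      by simp
  qed
  \<comment> \<open>In the difference of the lifts \<open>E h\<close> and \<open>F h\<close> the
    summand \<open>h\<close> cancels, so \<open>d h\<close> is a defect vector at
    \<open>\<nu>\<close>. Its first boundary value is \<open>b h\<close>, hence \<open>d\<close> is
    the \<open>\<gamma>\<close>-field at \<open>\<nu>\<close> applied to \<open>b\<close>.\<close>
  define d where "d h = t h - q h" for h
  have dT: "(d h, \<nu> *\<^sub>C d h) \<in> T" "\<Gamma>\<^sub>0 (d h, \<nu> *\<^sub>C d h) = b h"
    "\<Gamma>\<^sub>1 (d h, \<nu> *\<^sub>C d h) = \<Gamma>\<^sub>1 (E h) - c h" if h: "h \<in> H" for h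
  proof -
    have eq: "(d h, \<nu> *\<^sub>C d h) = E h - F h"
      by (simp add: d_def E_def F_def scaleC_diff_right)
    show "(d h, \<nu> *\<^sub>C d h) \<in> T"
      unfolding eq by (rule complex_vector.subspace_diff[OF T ET(1)[OF h] FT(1)[OF h]])
    show "\<Gamma>\<^sub>0 (d h, \<nu> *\<^sub>C d h) = b h" "\<Gamma>\<^sub>1 (d h, \<nu> *\<^sub>C d h) = \<Gamma>\<^sub>1 (E h) - c h"
      unfolding eq linear_map_on_diff[OF lin0 ET(1)[OF h] FT(1)[OF h]]
        linear_map_on_diff[OF lin1 ET(1)[OF h] FT(1)[OF h]]
      using FT(2)[OF h] by (simp_all add: b_def c_def)
  qed
  \<comment> \<open>The Weyl function maps \<open>b h\<close> to
    \<open>\<Gamma>\<^sub>1 (E h) - c h\<close>. Subtracting this from the second entry of the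
    boundary values of \<open>E h\<close>, which lie in \<open>\<Theta>\<close>, leaves
    \<open>c h\<close>.\<close>
  have N: "(b h, c h) \<in> rel_diff \<Theta> (weyl_function T \<Gamma>\<^sub>0 \<Gamma>\<^sub>1 \<nu>)" if h: "h \<in> H" for h
  proof -
    have "(d h, \<nu> *\<^sub>C d h) \<in> defect_space T \<nu>"
      using dT(1)[OF h] by (simp add: defect_space_def rel_ker_def)
    then have "(b h, \<Gamma>\<^sub>1 (E h) - c h) \<in> weyl_function T \<Gamma>\<^sub>0 \<Gamma>\<^sub>1 \<nu>"
      unfolding weyl_function_def using dT(2,3)[OF h] by force
    moreover have "(b h, \<Gamma>\<^sub>1 (E h)) \<in> \<Theta>"
      using ET(2)[OF h] by (simp add: b_def)
    ultimately show ?thesis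
      unfolding rel_diff_def by force
  qed
  have bb: "bounded_map_on H G b"
  proof (rule bounded_map_on_if_closed[OF hH hG linb])
    fix s x y
    assume s: "\<And>n. s n \<in> H" "s \<longlonglongrightarrow> x" "(\<lambda>n. b (s n)) \<longlonglongrightarrow> y" and x: "x \<in> H" and y: "y \<in> G"
    \<comment> \<open>As \<open>c\<close> is already known to be bounded, the second components tend
      to zero. The limit is thus of the form \<open>(y - b x, 0)\<close>, and injectivity of the
      closure applies.\<close>
    have lim: "(\<lambda>n. (b (s n) - b x, c (s n) - c x)) \<longlonglongrightarrow> (y - b x, c x - c x)"
      by (intro tendsto_Pair tendsto_diff tendsto_const s tendsto_bounded_map_on[OF bc] x)
    have "(b (s n) - b x, c (s n) - c x) \<in> rel_diff \<Theta> (weyl_function T \<Gamma>\<^sub>0 \<Gamma>\<^sub>1 \<nu>)" for n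
      using N[OF complex_vector.subspace_diff[OF H' s(1) x]]
      by (simp add: linear_map_on_diff[OF linb s(1) x] linear_map_on_diff[OF linc s(1) x])
    with lim have "(y - b x, c x - c x) \<in> closure (rel_diff \<Theta> (weyl_function T \<Gamma>\<^sub>0 \<Gamma>\<^sub>1 \<nu>))"
      unfolding closure_sequential by (intro exI[of _ "\<lambda>n. (b (s n) - b x, c (s n) - c x)"] conjI allI)
    then have "y - b x \<in> rel_ker (closure (rel_diff \<Theta> (weyl_function T \<Gamma>\<^sub>0 \<Gamma>\<^sub>1 \<nu>)))"
      by (simp add: rel_ker_def)
    then show "y = b x"
      using inj by simp
  qed
  obtain X where X: "X \<in> \<AA> G H" "rel_adj G H (gamma_field T \<Gamma>\<^sub>0 \<mu>) = rel_adj G H X"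
    using \<gamma> unfolding dual_ideal_class_def by blast
  have "\<AA> G H \<subseteq> compact_ops G H"
    using I sepG H by (simp add: operator_ideal_class_def)
  then have XB: "X \<in> bounded_ops G H"
    using X(1) by (auto simp: compact_ops_def)
  obtain \<xi> where \<xi>: "X = graph_on G \<xi>" "bounded_map_on G H \<xi>"
    using bounded_ops_graph_on[OF G' XB] by metis
  \<comment> \<open>The \<open>\<gamma>\<close>-field is defined only on the range of
    \<open>\<Gamma>\<^sub>0\<close>, whereas \<open>X\<close> is defined on all of \<open>G\<close>.
    Equality of the adjoints makes \<open>X\<close> an extension of it.\<close>
  have gx: "y = \<xi> x" if xy: "(x, y) \<in> gamma_field T \<Gamma>\<^sub>0 \<mu>" "x \<in> G" "y \<in> H" for x y
  proof -
    have "(x, y) \<in> X"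
    proof (rule mem_bounded_ops_if_adjoint[OF hG hH XB xy(2,3)])
      fix g g' assume "(g, g') \<in> rel_adj G H X"
      then show "cinner y g = cinner x g'"
        unfolding X(2)[symmetric] using xy(1) by (auto simp: rel_adj_def)
    qed
    then show ?thesis
      by (simp add: \<xi>)
  qed
  define v where "v h = h + (\<nu> - \<mu>) *\<^sub>C q h" for h
  have bv: "bounded_map_on H H v"
    unfolding v_def by (rule bounded_map_on_shift[OF q(2)])
  have dH: "d h \<in> H" if "h \<in> H" for h
    using that mem complex_vector.subspace_diff[OF H'] by (simp add: d_def)
  have key: "v (\<xi> (b h)) = t h - q h" if h: "h \<in> H" for h
  proof -
    \<comment> \<open>Adding a multiple of an element of \<open>A0\<close> leaves the first boundary
      value unchanged, and this multiple moves the defect vector \<open>d h\<close> from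
      \<open>\<nu>\<close> to \<open>\<mu>\<close>. Thus \<open>e\<close> is the
      \<open>\<gamma>\<close>-field at \<open>\<mu>\<close> applied to \<open>b h\<close>.\<close>
    define e where "e = d h + (\<mu> - \<nu>) *\<^sub>C p (d h)"
    have pd: "(p (d h), d h + \<mu> *\<^sub>C p (d h)) \<in> T" "\<Gamma>\<^sub>0 (p (d h), d h + \<mu> *\<^sub>C p (d h)) = 0"
      using p(3)[OF dH[OF h]] by (simp_all add: A0)
    have eq: "(e, \<mu> *\<^sub>C e) = (d h, \<nu> *\<^sub>C d h) + (\<mu> - \<nu>) *\<^sub>C (p (d h), d h + \<mu> *\<^sub>C p (d h))"
      by (simp add: e_def scaleC_prod_def scaleC_add_right scaleC_scaleC
          complex_vector.scale_left_diff_distrib algebra_simps)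
    have sc: "(\<mu> - \<nu>) *\<^sub>C (p (d h), d h + \<mu> *\<^sub>C p (d h)) \<in> T"
      by (rule complex_vector.subspace_scale[OF T pd(1)])
    have eT: "(e, \<mu> *\<^sub>C e) \<in> T"
      unfolding eq by (rule complex_vector.subspace_add[OF T dT(1)[OF h] sc])
    have "\<Gamma>\<^sub>0 (e, \<mu> *\<^sub>C e) = b h"
      unfolding eq linear_map_onD(3)[OF lin0 dT(1)[OF h] sc] linear_map_onD(4)[OF lin0 pd(1)] pd(2) dT(2)[OF h]
      by simp
    moreover have "(e, \<mu> *\<^sub>C e) \<in> defect_space T \<mu>"
      using eT by (simp add: defect_space_def rel_ker_def)
    ultimately have "(b h, e) \<in> gamma_field T \<Gamma>\<^sub>0 \<mu>"
      unfolding gamma_field_def by force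
    then have "e = \<xi> (b h)"
      using memb[OF h] eT TH by (intro gx) auto
    \<comment> \<open>The resolvent at \<open>\<nu>\<close> of \<open>e\<close> is the correction
      used to form \<open>e\<close> from \<open>d h\<close>, so the factor \<open>v\<close> undoes
      the passage from \<open>\<nu>\<close> to \<open>\<mu>\<close>.\<close>
    moreover have "q e = p (d h)"
      unfolding e_def by (rule resolvent_identity(1)[OF subA0 p(3,4) mem(2) q(3,4) mem(1) dH[OF h]])
    ultimately have "v (\<xi> (b h)) = e + (\<nu> - \<mu>) *\<^sub>C p (d h)"
      by (simp add: v_def)
    also have "\<dots> = d h"
      by (simp add: e_def complex_vector.scale_left_diff_distrib)
    finally show ?thesis
      by (simp add: d_def)
  qed
  have "graph_on H b O X O graph_on H v \<in> \<AA> H H"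
    by (rule operator_ideal_comp[OF I sepG H H H X(1) graph_on_bounded_ops[OF bb] graph_on_bounded_ops[OF bv]])
  also have "graph_on H b O X O graph_on H v = graph_on H (\<lambda>h. v (\<xi> (b h)))"
  proof -
    have "\<xi> ` G \<subseteq> H" "b ` H \<subseteq> G"
      using \<xi>(2) bb by (auto simp: bounded_map_on_def linear_map_on_def)
    then show ?thesis
      by (simp add: \<xi>(1) graph_on_comp)
  qed
  also have "\<dots> = rel_diff ((rel_shift A\<Theta> \<nu>)\<inverse>) ((rel_shift A0 \<nu>)\<inverse>)"
    unfolding t(1) q(1) rel_diff_graph_on by (rule graph_on_cong[OF key])
  finally show ?thesis
    by (simp only: A\<Theta>_def A0_def)
qed

section \<open>Passage from one nonreal point to all common resolvent points\<close>

theorem theorem3p19: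
  fixes H G :: "'a :: complex_inner set"
    and A A\<^sub>0 A\<^sub>\<Theta> T \<Theta> :: "('a \<times> 'a) set"
    and \<Gamma>\<^sub>0 \<Gamma>\<^sub>1 :: "'a \<times> 'a \<Rightarrow> 'a"
    and \<gamma> M :: "complex \<Rightarrow> ('a \<times> 'a) set"
    and \<AA> :: "'a set \<Rightarrow> 'a set \<Rightarrow> ('a \<times> 'a) set set"
  defines "A\<^sub>0 \<equiv> map_ker T \<Gamma>\<^sub>0"
    and "\<gamma> \<equiv> gamma_field T \<Gamma>\<^sub>0"
    and "M \<equiv> weyl_function T \<Gamma>\<^sub>0 \<Gamma>\<^sub>1"
    and "A\<^sub>\<Theta> \<equiv> restriction_by T \<Gamma>\<^sub>0 \<Gamma>\<^sub>1 \<Theta>"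
  assumes "separable_hilbert_space H"
    and "symmetric_relation H A" and "closed A"
    and "quasi_boundary_triple H A T G \<Gamma>\<^sub>0 \<Gamma>\<^sub>1"
    and "operator_ideal_class \<AA>"
    and "symmetric_relation G \<Theta>"
    and "\<exists>\<mu>\<^sub>0. \<mu>\<^sub>0 \<notin> \<real> \<and> rel_ker (closure (rel_diff \<Theta> (M \<mu>\<^sub>0))) = {0}"
    and "\<exists>\<mu>\<^sub>1\<in>resolvent_set H A\<^sub>0. rel_adj G H (\<gamma> \<mu>\<^sub>1) \<in> dual_ideal_class \<AA> H G"
    and "A\<^sub>\<Theta> = rel_adj H H A\<^sub>\<Theta>"
  shows "\<forall>\<mu>\<in>resolvent_set H A\<^sub>\<Theta> \<inter> resolvent_set H A\<^sub>0.
    rel_diff ((rel_shift A\<^sub>\<Theta> \<mu>)\<inverse>) ((rel_shift A\<^sub>0 \<mu>)\<inverse>) \<in> \<AA> H H"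
proof
  note H = \<open>separable_hilbert_space H\<close> and Q = \<open>quasi_boundary_triple H A T G \<Gamma>\<^sub>0 \<Gamma>\<^sub>1\<close>
    and I = \<open>operator_ideal_class \<AA>\<close>
  fix \<mu> assume \<mu>: "\<mu> \<in> resolvent_set H A\<^sub>\<Theta> \<inter> resolvent_set H A\<^sub>0"
  obtain \<mu>\<^sub>0 where \<mu>\<^sub>0: "\<mu>\<^sub>0 \<notin> \<real>" "rel_ker (closure (rel_diff \<Theta> (M \<mu>\<^sub>0))) = {0}"
    using \<open>\<exists>\<mu>\<^sub>0. \<mu>\<^sub>0 \<notin> \<real> \<and> _ \<mu>\<^sub>0\<close> by blast
  obtain \<mu>\<^sub>1 where \<mu>\<^sub>1: "\<mu>\<^sub>1 \<in> resolvent_set H A\<^sub>0" "rel_adj G H (\<gamma> \<mu>\<^sub>1) \<in> dual_ideal_class \<AA> H G"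
    using \<open>\<exists>\<mu>\<^sub>1\<in>resolvent_set H A\<^sub>0. _ \<mu>\<^sub>1\<close> by blast
  have hH: "hilbert_space H"
    using H by (simp add: separable_hilbert_space_def)
  have \<Theta>: "csubspace \<Theta>"
    using \<open>symmetric_relation G \<Theta>\<close> by (simp add: symmetric_relation_def linear_relation_def)
  have lin: "linear_map_on T G \<Gamma>\<^sub>0" "linear_map_on T G \<Gamma>\<^sub>1" and TH: "T \<subseteq> H \<times> H"
    and sa0: "self_adjoint_relation H A\<^sub>0"
    using Q by (auto simp: quasi_boundary_triple_def A\<^sub>0_def rel_adj_def)
  have lin0: "linear_relation H H A\<^sub>0"
    using sa0 by (simp add: self_adjoint_relation_def)
  have lin\<Theta>: "linear_relation H H A\<^sub>\<Theta>"
    unfolding A\<^sub>\<Theta>_def by (rule linear_relation_restriction_by[OF lin TH \<Theta>])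
  then have sa\<Theta>: "self_adjoint_relation H A\<^sub>\<Theta>"
    using \<open>A\<^sub>\<Theta> = rel_adj H H A\<^sub>\<Theta>\<close> by (simp add: self_adjoint_relation_def)
  \<comment> \<open>Both relations are self-adjoint, so the nonreal point of the injectivity
    hypothesis is a common resolvent point, as the two lemmas below require.\<close>
  have \<rho>: "\<mu>\<^sub>0 \<in> resolvent_set H A\<^sub>\<Theta>" "\<mu>\<^sub>0 \<in> resolvent_set H A\<^sub>0"
    by (intro nonreal_in_resolvent_set hH sa\<Theta> sa0 \<mu>\<^sub>0(1))+
  have "rel_diff ((rel_shift A\<^sub>\<Theta> \<mu>\<^sub>0)\<inverse>) ((rel_shift A\<^sub>0 \<mu>\<^sub>0)\<inverse>) \<in> \<AA> H H"
    using resolvent_difference_at_point[OF H Q I _ _ \<Theta>] \<rho> \<mu>\<^sub>0(2) \<mu>\<^sub>1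
    unfolding A\<^sub>\<Theta>_def A\<^sub>0_def M_def \<gamma>_def by blast
  then show "rel_diff ((rel_shift A\<^sub>\<Theta> \<mu>)\<inverse>) ((rel_shift A\<^sub>0 \<mu>)\<inverse>) \<in> \<AA> H H"
    by (rule resolvent_difference_in_ideal[OF I H lin\<Theta> lin0 IntD1[OF \<mu>] IntD2[OF \<mu>] \<rho>])
qed

end
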